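(* Let $x_*$ be a local minimizer of $F=f+\mu\|\cdot\|_1$ on $\mathcal M$, with coordinates ordered so that $x_*=[\bar x_*^T,0^T]^T$, where $\bar x_*\in\mathbb R^j$ has no zero entry, and fix $t>0$. Assume: (i) $f$ is twice continuously differentiable and $\nabla f$ is Lipschitz continuous; (ii) there is a neighborhood $\mathcal U_{x_*}$ of $x_*$ on $\mathcal M$ such that for all $x\in\mathcal U_{x_*}$ the first $j$ entries of $x+v(x)$ are all nonzero and the last $n-j$ entries are all zero; (iii) $j\ge c$ and $\bar B_{x_*}\in\mathbb R^{j\times c}$ has full column rank; (iv) $F$ is geodesically $\varsigma$-strongly convex at $x_*$ for some $\varsigma>0$, i.e. there is a neighborhood $\tilde{\mathcal U}_{x_*}$ of $x_*$ on which $\mathrm{Exp}_{x_*}^{-1}$ is a well-defined diffeomorphism and $F(y)\ge F(x_* )+\frac{\varsigma}{2}\|\mathrm{Exp}_{x_*}^{-1}(y)\|_F^2$ for all $y\in\tilde{\mathcal U}_{x_*}$; (v) there exist a neighborhood $\mathcal V_9$ of $x_*$, a constant $C_{\mathrm{up}}>0$ and $\varkappa>\sqrt2$ such that for every $x\in\mathcal V_9$, $\|R_x(d(x))-x_*\|_F\le C_{\mathrm{up}}\|x-x_*\|_F^{\varkappa}$ and $R_x(d(x))\in\mathcal V_9$. Then there exist a neighborhood $\mathcal V_{10}$ of $x_*$ and a constant $\rho_1>0$ such that for every $x\in\mathcal V_{10}$, $$F(x_{++})\le F(x)-\rho_1\|v(x)\|_F^2,$$ where $x_+=R_x(d(x))$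 and $x_{++}=R_{x_+}(d(x_+))$.
   Context: Setting. $\mathbb R^n$ carries the Euclidean inner product $\langle\cdot,\cdot\rangle$ and norm $\|\cdot\|_F$. $\mathcal M\subset\mathbb R^n$ is a compact embedded submanifold with the induced Riemannian metric; $c=n-\dim\mathcal M$; $T_x\mathcal M$, $N_x\mathcal M$ are tangent and normal spaces; $P_L$ is the orthogonal projection onto a subspace $L$; $\mathrm{Exp}$ is the exponential map of $\mathcal M$. $F=f+h$ with $h(x)=\mu\|x\|_1$, $\mu>0$, $f:\mathbb R^n\to\mathbb R$ with Euclidean gradient $\nabla f$ and Hessian $\nabla^2f$. $R$ is a retraction: a smooth map $T\mathcal M\to\mathcal M$ with $R_x(0_x)=x$, $\mathrm D R_x(0_x)=\mathrm{id}$. $B_x\in\mathbb R^{n\times c}$ has as columns an orthonormal basis of $N_x\mathcal M$, so $T_x\mathcal M=\{v:B_x^Tv=0\}$ (chosen smoothly in $x$ near $x_*$). The Weingarten map is $\mathcal W_x(w,u)=(\mathrm D(y\mapsto P_{T_y\mathcal M})(x)[w])u$ for $w\in T_x\mathcal M$, $u\in N_x\mathcal M$. Proximal gradient direction. For $t>0$, $v(x)=\arg\min_{v\in T_x\mathcal M} f(x)+\langle\nabla f(x),v\rangle+\frac1{2t}\|v\|_F^2+h(x+v)$, and $\lambda(x)\in\mathbb R^{c}$ is a Lagrange multiplier, i.e. $v(x)=\mathrm{prox}_{th}(x-t[\nabla f(x)+B_x\lambda(x)])-x$ with $\mathrm{prox}_{th}(z)=\max(|z|-t\mu,0)\odot\mathrm{sign}(z)$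 and $B_x^Tv(x)=0$. Partition. Let $j$ be the number of nonzero entries of $x+v(x)$; order coordinates so these are the first $j$. For a vector or matrix $A$ with $n$ rows, $\bar A$ is its first $j$ rows and $\hat A$ its last $n-j$ rows. $\mathcal L_x(\cdot)=\mathcal W_x(\cdot,B_x\lambda(x))$, regarded as a symmetric operator on $\mathbb R^n$ by precomposition with $P_{T_x\mathcal M}$; $\mathfrak B_x=\nabla^2f(x)-\mathcal L_x=\begin{pmatrix}\mathcal B_x&\mathfrak B_x^{(12)}\\ \mathfrak B_x^{(21)}&\mathfrak B_x^{(22)}\end{pmatrix}$ with $\mathcal B_x\in\mathbb R^{j\times j}$. All these depend on $t$. Put $\ell_{x,t}=\frac1t(-I_j+t\mathcal B_x)\bar v(x)+\mathfrak B_x^{(12)}\hat v(x)$. Truncated CG (tCG). Parameters $\vartheta,\gamma,\tau,\theta>0$, $\kappa\in(0,1)$. $P_x=I_j-\bar B_x\bar B_x^\dagger$; $G_x(u)=f(x)+\langle\nabla f(x),u\rangle+\frac12\langle u,\mathfrak B_xu\rangle+\frac\tau2\|\hat u\|_F^2+h(x+u)$. Output $w(x)$: (1) If $G_x(v(x))>G_x(0)$, return $w(x)=0$. (2) If $\langle v(x),\mathfrak B_xv(x)\rangle+\tau\|\hat v(x)\|_F^2<\gamma\|v(x)\|_F^2$, return $w(x)=0$. (3) $w_0=0$, $r_0=P_x\ell_{x,t}$, $o_0=-r_0$, $\delta_0=\langle r_0,r_0\rangle$. For $i=0,1,\dots$: $q_i=P_x\mathcal B_xo_i$; if $\langle o_i,q_i\rangle\le\vartheta\delta_i$,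 return $w(x)=w_i$. Set $\alpha_i=\langle r_i,r_i\rangle/\langle o_i,q_i\rangle$, $w_{i+1}=w_i+\alpha_io_i$, $r_{i+1}=r_i+\alpha_iq_i$, $d_{i+1}=\begin{pmatrix}\bar v(x)+w_{i+1}\\ \hat v(x)\end{pmatrix}$. If $\langle d_{i+1},\mathfrak B_xd_{i+1}\rangle+\tau\|\hat v(x)\|_F^2<\gamma\|d_{i+1}\|_F^2$ or $G_x(d_{i+1})>G_x(0)$, return $w(x)=w_i$. Set $\beta_{i+1}=\langle r_{i+1},r_{i+1}\rangle/\langle r_i,r_i\rangle$, $o_{i+1}=-r_{i+1}+\beta_{i+1}o_i$, $\delta_{i+1}=\langle r_{i+1},r_{i+1}\rangle+\beta_{i+1}^2\delta_i$. If $\|r_{i+1}\|_F\le\|r_0\|_F\min(\|r_0\|_F^\theta,\kappa)$, return $w(x)=w_{i+1}$. The search direction is $d(x)=\begin{pmatrix}\bar v(x)+w(x)\\ \hat v(x)\end{pmatrix}$. *)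

theory Defs
  imports "HOL-Analysis.Analysis"
begin

section \<open>Differentiability classes and smooth maps\<close>

text \<open>\<open>Ck_on k f S\<close> is meant for open \<open>S\<close>: all directional derivatives of order up to \<open>k\<close>
  exist as values of Frechet derivatives, and those of order \<open>k\<close> are continuous.\<close>

primrec Ck_on :: "nat \<Rightarrow> ('a::real_normed_vector \<Rightarrow> 'b::real_normed_vector) \<Rightarrow> 'a set \<Rightarrow> bool" where
  "Ck_on 0 f S \<longleftrightarrow> continuous_on S f"
| "Ck_on (Suc k) f S \<longleftrightarrow>
     (\<forall>x\<in>S. f differentiable (at x)) \<and> (\<forall>v. Ck_on k (\<lambda>x. frechet_derivative f (at x) v) S)"

definition smooth_on :: "('a::real_normed_vector \<Rightarrow> 'b::real_normed_vector) \<Rightarrow> 'a set \<Rightarrow> bool" where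
  "smooth_on f S \<longleftrightarrow> (\<forall>k. Ck_on k f S)"

text \<open>Smoothness on an arbitrary subset of a Euclidean space: local smooth extendability.  For a
  subset that is an embedded submanifold (in particular, an open set, a submanifold itself, or the
  tangent bundle inside the product space) this is the usual smoothness.\<close>

definition smooth_map_on :: "('a::real_normed_vector \<Rightarrow> 'b::real_normed_vector) \<Rightarrow> 'a set \<Rightarrow> bool" where
  "smooth_map_on g A \<longleftrightarrow>
     (\<forall>a\<in>A. \<exists>U G. open U \<and> a \<in> U \<and> smooth_on G U \<and> (\<forall>y\<in>U \<inter> A. G y = g y))"

definition diffeo_on ::
    "('a::real_normed_vector \<Rightarrow> 'b::real_normed_vector) \<Rightarrow> 'a set \<Rightarrow> 'b set \<Rightarrow> bool" where
  "diffeo_on g A C \<longleftrightarrow>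
     bij_betw g A C \<and> smooth_map_on g A \<and> smooth_map_on (inv_into A g) C"

definition grad :: "('a::real_inner \<Rightarrow> real) \<Rightarrow> 'a \<Rightarrow> 'a" where
  "grad f x = (THE g. GDERIV f x :> g)"

definition hess :: "('a::real_inner \<Rightarrow> real) \<Rightarrow> 'a \<Rightarrow> 'a \<Rightarrow> 'a" where
  "hess f x = frechet_derivative (grad f) (at x)"


section \<open>Embedded submanifolds of Euclidean space\<close>

text \<open>\<open>m\<close>-dimensional slice charts around every point.\<close>

definition embedded_submanifold :: "nat \<Rightarrow> 'a::euclidean_space set \<Rightarrow> bool" where
  "embedded_submanifold m M \<longleftrightarrow>
     (\<forall>x\<in>M. \<exists>U V \<Psi> S. open U \<and> x \<in> U \<and> open (V :: 'a set) \<and> diffeo_on \<Psi> U V \<and>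
        subspace S \<and> dim S = m \<and> \<Psi> ` (U \<inter> M) = V \<inter> S)"

definition curve_in :: "'a::euclidean_space set \<Rightarrow> 'a \<Rightarrow> 'a \<Rightarrow> (real \<Rightarrow> 'a) \<Rightarrow> bool" where
  "curve_in M x v \<gamma> \<longleftrightarrow>
     (\<exists>e>0. smooth_on \<gamma> {-e<..<e} \<and> \<gamma> ` {-e<..<e} \<subseteq> M) \<and>
     \<gamma> 0 = x \<and> (\<gamma> has_vector_derivative v) (at 0)"

definition tangent_space :: "'a::euclidean_space set \<Rightarrow> 'a \<Rightarrow> 'a set" where
  "tangent_space M x = {v. \<exists>\<gamma>. curve_in M x v \<gamma>}"

definition normal_space_at :: "'a::euclidean_space set \<Rightarrow> 'a \<Rightarrow> 'a set" where
  "normal_space_at M x = orthogonal_comp (tangent_space M x)"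

definition tangent_bundle :: "'a::euclidean_space set \<Rightarrow> ('a \<times> 'a) set" where
  "tangent_bundle M = {(x, v). x \<in> M \<and> v \<in> tangent_space M x}"

definition nbhd_on :: "'a::topological_space set \<Rightarrow> 'a \<Rightarrow> 'a set \<Rightarrow> bool" where
  "nbhd_on M x V \<longleftrightarrow> V \<subseteq> M \<and> (\<exists>U. open U \<and> x \<in> U \<and> U \<inter> M \<subseteq> V)"

definition orth_proj :: "'a::real_inner set \<Rightarrow> 'a \<Rightarrow> 'a" where
  "orth_proj L u = (THE p. p \<in> L \<and> (\<forall>z\<in>L. (u - p) \<bullet> z = 0))"

text \<open>\<open>D g(x)[w]\<close> for a map \<open>g\<close> defined on \<open>M\<close> and \<open>w\<close> tangent to \<open>M\<close> at \<open>x\<close>.\<close>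

definition deriv_along ::
    "'a::euclidean_space set \<Rightarrow> ('a \<Rightarrow> 'b::real_normed_vector) \<Rightarrow> 'a \<Rightarrow> 'a \<Rightarrow> 'b" where
  "deriv_along M g x w =
     (THE D. \<forall>\<gamma>. curve_in M x w \<gamma> \<longrightarrow> ((\<lambda>s. g (\<gamma> s)) has_vector_derivative D) (at 0))"

definition weingarten :: "'a::euclidean_space set \<Rightarrow> 'a \<Rightarrow> 'a \<Rightarrow> 'a \<Rightarrow> 'a" where
  "weingarten M x w u = deriv_along M (\<lambda>y. orth_proj (tangent_space M y) u) x w"

text \<open>The Levi-Civita covariant derivative of the velocity of a curve, for the metric induced on
  \<open>M\<close>, is the tangential part of the acceleration.\<close>

definition geodesic_on :: "'a::euclidean_space set \<Rightarrow> real \<Rightarrow> real \<Rightarrow> (real \<Rightarrow> 'a) \<Rightarrow> bool" where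
  "geodesic_on M a b \<gamma> \<longleftrightarrow>
     smooth_on \<gamma> {a<..<b} \<and> \<gamma> ` {a<..<b} \<subseteq> M \<and>
     (\<forall>s\<in>{a<..<b}. orth_proj (tangent_space M (\<gamma> s))
        (vector_derivative (\<lambda>r. vector_derivative \<gamma> (at r)) (at s)) = 0)"

definition exp_geodesic :: "'a::euclidean_space set \<Rightarrow> 'a \<Rightarrow> 'a \<Rightarrow> (real \<Rightarrow> 'a) \<Rightarrow> bool" where
  "exp_geodesic M x v \<gamma> \<longleftrightarrow>
     (\<exists>a b. a < 0 \<and> 1 < b \<and> geodesic_on M a b \<gamma>) \<and>
     \<gamma> 0 = x \<and> (\<gamma> has_vector_derivative v) (at 0)"

definition exp_dom :: "'a::euclidean_space set \<Rightarrow> 'a \<Rightarrow> 'a set" where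
  "exp_dom M x = {v \<in> tangent_space M x. \<exists>\<gamma>. exp_geodesic M x v \<gamma>}"

text \<open>By uniqueness of geodesics the choice below is no choice on \<open>exp_dom M x\<close>, which is the whole
  tangent space when \<open>M\<close> is a compact submanifold.\<close>

definition riem_exp :: "'a::euclidean_space set \<Rightarrow> 'a \<Rightarrow> 'a \<Rightarrow> 'a" where
  "riem_exp M x v = (SOME \<gamma>. exp_geodesic M x v \<gamma>) 1"

definition retraction_on_mfd :: "'a::euclidean_space set \<Rightarrow> ('a \<Rightarrow> 'a \<Rightarrow> 'a) \<Rightarrow> bool" where
  "retraction_on_mfd M R \<longleftrightarrow>
     smooth_map_on (\<lambda>(x, v). R x v) (tangent_bundle M) \<and>
     (\<forall>(x, v)\<in>tangent_bundle M. R x v \<in> M) \<and>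
     (\<forall>x\<in>M. R x 0 = x \<and> (R x has_derivative (\<lambda>v. v)) (at 0 within tangent_space M x))"

definition local_minimizer_on :: "'a::topological_space set \<Rightarrow> ('a \<Rightarrow> real) \<Rightarrow> 'a \<Rightarrow> bool" where
  "local_minimizer_on M F x \<longleftrightarrow> x \<in> M \<and> (\<exists>V. nbhd_on M x V \<and> (\<forall>y\<in>V. F x \<le> F y))"

definition geod_strongly_convex_at ::
    "'a::euclidean_space set \<Rightarrow> ('a \<Rightarrow> real) \<Rightarrow> real \<Rightarrow> 'a \<Rightarrow> bool" where
  "geod_strongly_convex_at M F \<sigma> x \<longleftrightarrow>
     (\<exists>U W. openin (top_of_set M) U \<and> x \<in> U \<and>
        openin (top_of_set (tangent_space M x)) W \<and> 0 \<in> W \<and> W \<subseteq> exp_dom M x \<and>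
        diffeo_on (riem_exp M x) W U \<and>
        (\<forall>y\<in>U. F y \<ge> F x + \<sigma> / 2 * (norm (inv_into W (riem_exp M x) y))\<^sup>2))"


section \<open>Matrices and coordinate blocks\<close>

definition orthonormal_basis_columns :: "real^'c^'n \<Rightarrow> (real^'n) set \<Rightarrow> bool" where
  "orthonormal_basis_columns B N \<longleftrightarrow> transpose B ** B = mat 1 \<and> span (columns B) = N"

text \<open>Moore-Penrose inverse.\<close>

definition pinv :: "real^'c^'n \<Rightarrow> real^'n^'c" where
  "pinv A = (THE X. A ** X ** A = A \<and> X ** A ** X = X \<and>
     transpose (A ** X) = A ** X \<and> transpose (X ** A) = X ** A)"

text \<open>A partition of the coordinates is given by the index set \<open>J\<close> of the leading block instead of
  by a reordering.  A block is represented by the vector (matrix) of full size whose entries (rows)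
  outside the block are zero; inner products, norms, matrix products, ranks and Moore-Penrose
  inverses are the same as for the block itself.\<close>

definition supp :: "real^'n \<Rightarrow> 'n set" where
  "supp x = {i. x $ i \<noteq> 0}"

definition blk :: "'n set \<Rightarrow> real^'n \<Rightarrow> real^'n" where
  "blk J u = (\<chi> i. if i \<in> J then u $ i else 0)"

definition row_blk :: "'n set \<Rightarrow> real^'c^'n \<Rightarrow> real^'c^'n" where
  "row_blk J A = (\<chi> i. if i \<in> J then A $ i else 0)"

definition id_blk :: "'n set \<Rightarrow> real^'n^'n" where
  "id_blk J = (\<chi> i k. if i = k \<and> i \<in> J then 1 else 0)"


section \<open>Proximal gradient direction\<close>

definition l1norm :: "real^'n \<Rightarrow> real" where
  "l1norm x = (\<Sum>i\<in>UNIV. \<bar>x $ i\<bar>)"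

text \<open>\<open>prox_l1 a\<close> is the proximal map of \<open>a\<close> times the 1-norm.\<close>

definition prox_l1 :: "real \<Rightarrow> real^'n \<Rightarrow> real^'n" where
  "prox_l1 a z = (\<chi> i. max (\<bar>z $ i\<bar> - a) 0 * sgn (z $ i))"

definition prox_dir ::
    "(real^'n) set \<Rightarrow> (real^'n \<Rightarrow> real) \<Rightarrow> real \<Rightarrow> real \<Rightarrow> real^'n \<Rightarrow> real^'n" where
  "prox_dir M f \<mu> t x =
     (ARG_MIN (\<lambda>v. f x + grad f x \<bullet> v + 1 / (2 * t) * (norm v)\<^sup>2 + \<mu> * l1norm (x + v)) v.
        v \<in> tangent_space M x)"

definition is_multiplier ::
    "(real^'n) set \<Rightarrow> (real^'n \<Rightarrow> real) \<Rightarrow> real \<Rightarrow> real \<Rightarrow> real^'c^'n \<Rightarrow> real^'n \<Rightarrow> real^'c \<Rightarrow> bool" where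
  "is_multiplier M f \<mu> t Bx x l \<longleftrightarrow>
     prox_dir M f \<mu> t x = prox_l1 (t * \<mu>) (x - t *\<^sub>R (grad f x + Bx *v l)) - x \<and>
     transpose Bx *v prox_dir M f \<mu> t x = 0"


section \<open>Truncated conjugate gradients\<close>

text \<open>The operator \<open>u \<mapsto> Hess f(x) u - W(P u, B l)\<close>, with \<open>P\<close> the projection onto the tangent space.\<close>

definition frakB ::
    "(real^'n) set \<Rightarrow> (real^'n \<Rightarrow> real) \<Rightarrow> real^'c^'n \<Rightarrow> real^'c \<Rightarrow> real^'n \<Rightarrow> real^'n \<Rightarrow> real^'n" where
  "frakB M f Bx l x u =
     hess f x u - weingarten M x (orth_proj (tangent_space M x) u) (Bx *v l)"

text \<open>In the following, \<open>H\<close> stands for this operator and \<open>J\<close> for the leading index block at \<open>x\<close>,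
  that is, the support of \<open>x + v(x)\<close>.\<close>

definition tcg_model ::
    "(real^'n \<Rightarrow> real) \<Rightarrow> real \<Rightarrow> real \<Rightarrow> (real^'n \<Rightarrow> real^'n) \<Rightarrow> 'n set \<Rightarrow> real^'n \<Rightarrow> real^'n \<Rightarrow> real" where
  "tcg_model f \<mu> \<tau> H J x u =
     f x + grad f x \<bullet> u + 1 / 2 * (u \<bullet> H u) + \<tau> / 2 * (norm (blk (-J) u))\<^sup>2 + \<mu> * l1norm (x + u)"

text \<open>The loop from state \<open>(w\<^sub>i, r\<^sub>i, o\<^sub>i, \<delta>\<^sub>i)\<close>.  \<open>Q\<close> is the map \<open>o \<mapsto> P B o\<close>, \<open>bad\<close> the
  rejection test on the next iterate, and \<open>tol\<close> the bound on the residual.  In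
  \<open>tcg_output\<close> the loop is exact conjugate gradients for a symmetric operator on a
  finite-dimensional space, so it stops.\<close>

partial_function (tailrec) tcg_loop ::
    "('a::real_inner \<Rightarrow> 'a) \<Rightarrow> ('a \<Rightarrow> bool) \<Rightarrow> real \<Rightarrow> real \<Rightarrow> 'a \<Rightarrow> 'a \<Rightarrow> 'a \<Rightarrow> real \<Rightarrow> 'a" where
  "tcg_loop Q bad vth tol w r p \<delta> =
     (let q = Q p in
      if p \<bullet> q \<le> vth * \<delta> then w
      else
        let \<alpha> = (r \<bullet> r) / (p \<bullet> q); w' = w + \<alpha> *\<^sub>R p; r' = r + \<alpha> *\<^sub>R q in
        if bad w' then w
        else
          let \<beta> = (r' \<bullet> r') / (r \<bullet> r); p' = - r' + \<beta> *\<^sub>R p; \<delta>' = r' \<bullet> r' + \<beta>\<^sup>2 * \<delta> in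
          if norm r' \<le> tol then w'
          else tcg_loop Q bad vth tol w' r' p' \<delta>')"

definition tcg_output ::
    "(real^'n \<Rightarrow> real) \<Rightarrow> real \<Rightarrow> real \<Rightarrow> real \<Rightarrow> real \<Rightarrow> real \<Rightarrow> real \<Rightarrow> real \<Rightarrow>
     (real^'n \<Rightarrow> real^'n) \<Rightarrow> 'n set \<Rightarrow> real^'c^'n \<Rightarrow> real^'n \<Rightarrow> real^'n \<Rightarrow> real^'n" where
  "tcg_output f \<mu> t vth \<gamma> \<tau> \<theta> \<kappa> H J Bx x v =
     (let G = tcg_model f \<mu> \<tau> H J x;
          P = id_blk J - row_blk J Bx ** pinv (row_blk J Bx);
          BJ = (\<lambda>u. blk J (H (blk J u)));
          l = (1 / t) *\<^sub>R (- blk J v + t *\<^sub>R BJ (blk J v)) + blk J (H (blk (-J) v));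
          r0 = P *v l;
          bad = (\<lambda>d. d \<bullet> H d + \<tau> * (norm (blk (-J) v))\<^sup>2 < \<gamma> * (norm d)\<^sup>2)
      in
        if G v > G 0 then 0
        else if bad v then 0
        else tcg_loop (\<lambda>u. P *v BJ u)
               (\<lambda>w. let d = blk J v + w + blk (-J) v in bad d \<or> G d > G 0)
               vth (norm r0 * min (norm r0 powr \<theta>) \<kappa>)
               0 r0 (- r0) (r0 \<bullet> r0))"

definition search_dir ::
    "(real^'n) set \<Rightarrow> (real^'n \<Rightarrow> real) \<Rightarrow> real \<Rightarrow> real \<Rightarrow> real \<Rightarrow> real \<Rightarrow> real \<Rightarrow> real \<Rightarrow> real \<Rightarrow>
     (real^'n \<Rightarrow> real^'c^'n) \<Rightarrow> (real^'n \<Rightarrow> real^'c) \<Rightarrow> real^'n \<Rightarrow> real^'n" where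
  "search_dir M f \<mu> t vth \<gamma> \<tau> \<theta> \<kappa> B lam x =
     (let v = prox_dir M f \<mu> t x; J = supp (x + v);
          w = tcg_output f \<mu> t vth \<gamma> \<tau> \<theta> \<kappa> (frakB M f (B x) (lam x) x) J (B x) x v
      in blk J v + w + blk (-J) v)"

end

theory Submission
  imports Defs
begin

text \<open>Write \<open>\<epsilon>\<close> for the distance from \<open>x\<close> to \<open>xs\<close>. Two superlinear steps of order greater than
  \<open>sqrt 2\<close> bring the distance down to \<open>o(\<epsilon>\<^sup>2)\<close>, hence \<open>F x\<^sub>2 - F xs = o(\<epsilon>\<^sup>2)\<close> because \<open>F\<close> is Lipschitz
  at \<open>xs\<close>, whereas strong convexity gives \<open>F x - F xs \<ge> c \<epsilon>\<^sup>2\<close>. It remains to see that \<open>v x = O(\<epsilon>)\<close>.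
  On vectors supported in \<open>J\<close> and tangent at \<open>x\<close>, the multiplier equation says that
  \<open>grad f x + v x / t + \<mu> sgn (x + v x)\<close> vanishes; local minimality says the same of
  \<open>grad f xs + \<mu> sgn xs\<close> at \<open>xs\<close>. Full column rank of the leading block of \<open>B xs\<close> allows one to
  correct \<open>v x\<close> by \<open>O(\<epsilon>)\<close> into such a test vector, and subtracting the two equations bounds it.\<close>

text \<open>As a simp rule this would turn \<open>transpose A *v u\<close> into
  \<open>u v* A\<close>; the first form is kept throughout, as in
  \<open>is_multiplier\<close>.\<close>

declare transpose_matrix_vector [simp del]

section \<open>Smooth maps and their first-order estimates\<close>

lemma Ck_on_cong:
  assumes "open S" "\<And>x. x \<in> S \<Longrightarrow> f x = g x" "Ck_on k f S"
  shows "Ck_on k g S"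
  using assms(2,3)
proof (induction k arbitrary: f g)
  case 0
  then show ?case
    by (metis Ck_on.simps(1) continuous_on_cong)
next
  case (Suc k)
  have deriv: "(g has_derivative frechet_derivative f (at x)) (at x)" if "x \<in> S" for x
  proof (rule has_derivative_transform_within_open[OF _ \<open>open S\<close> that Suc.prems(1)])
    show "(f has_derivative frechet_derivative f (at x)) (at x)"
      using Suc.prems(2) that by (simp add: frechet_derivative_works)
  qed
  have "Ck_on k (\<lambda>x. frechet_derivative g (at x) v) S" for v
  proof (rule Suc.IH)
    show "Ck_on k (\<lambda>x. frechet_derivative f (at x) v) S"
      using Suc.prems(2) by simp
    show "frechet_derivative f (at x) v = frechet_derivative g (at x) v" if "x \<in> S" for x
      using frechet_derivative_at[OF deriv[OF that]] by simp
  qed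
  then show ?case
    using deriv by (auto simp: differentiable_def)
qed

text \<open>The derivative of the composite in direction \<open>r\<close> is that of
  \<open>g\<close> in direction \<open>r *\<^sub>R b\<close>, composed with the same affine map, so
  the induction over all \<open>g\<close> closes. It makes lines in a chart into smooth
  curves.\<close>

lemma Ck_on_affine_compose:
  fixes g :: "'a::real_normed_vector \<Rightarrow> 'b::real_normed_vector"
  assumes "open I" "(\<lambda>s::real. a + s *\<^sub>R b) ` I \<subseteq> S" "Ck_on k g S"
  shows "Ck_on k (\<lambda>s. g (a + s *\<^sub>R b)) I"
  using assms(3)
proof (induction k arbitrary: g)
  case 0
  have "continuous_on I (\<lambda>s. a + s *\<^sub>R b)"
    by (intro continuous_intros)
  then show ?case
    using continuous_on_compose2[OF _ _ assms(2), of g] 0 by simp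
next
  case (Suc k)
  have deriv: "((\<lambda>s. g (a + s *\<^sub>R b)) has_derivative
      (\<lambda>r. frechet_derivative g (at (a + s *\<^sub>R b)) (r *\<^sub>R b))) (at s)" if "s \<in> I" for s
  proof (rule has_derivative_compose[of "\<lambda>s. a + s *\<^sub>R b" "\<lambda>r. r *\<^sub>R b"])
    show "((\<lambda>s. a + s *\<^sub>R b) has_derivative (\<lambda>r. r *\<^sub>R b)) (at s)"
      by (auto intro!: derivative_eq_intros)
    show "(g has_derivative frechet_derivative g (at (a + s *\<^sub>R b))) (at (a + s *\<^sub>R b))"
      using Suc.prems that assms(2) by (auto simp: frechet_derivative_works)
  qed
  have "Ck_on k (\<lambda>s. frechet_derivative (\<lambda>s. g (a + s *\<^sub>R b)) (at s) r) I" for r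
  proof (rule Ck_on_cong[OF \<open>open I\<close>])
    show "Ck_on k (\<lambda>s. frechet_derivative g (at (a + s *\<^sub>R b)) (r *\<^sub>R b)) I"
      using Suc.prems by (intro Suc.IH) simp
    show "frechet_derivative g (at (a + s *\<^sub>R b)) (r *\<^sub>R b)
        = frechet_derivative (\<lambda>s. g (a + s *\<^sub>R b)) (at s) r" if "s \<in> I" for s
      using frechet_derivative_at[OF deriv[OF that]] by metis
  qed
  then show ?case
    using deriv by (auto simp: differentiable_def)
qed

lemma smooth_on_affine_compose:
  fixes g :: "'a::real_normed_vector \<Rightarrow> 'b::real_normed_vector"
  assumes "open I" "(\<lambda>s::real. a + s *\<^sub>R b) ` I \<subseteq> S" "smooth_on g S"
  shows "smooth_on (\<lambda>s. g (a + s *\<^sub>R b)) I"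
  using assms unfolding smooth_on_def by (blast intro: Ck_on_affine_compose)

lemma smooth_on_differentiable:
  assumes "smooth_on g S" "x \<in> S"
  shows "g differentiable (at x)"
  using assms(1)[unfolded smooth_on_def, rule_format, of "Suc 0"] assms(2) by simp

text \<open>One endpoint is fixed at \<open>a\<close>, so differentiability at that point is enough:
  take error tolerance 1 in the definition of the derivative and add the bound of the linear
  part.\<close>

lemma differentiable_pointwise_lipschitz:
  fixes g :: "'a::real_normed_vector \<Rightarrow> 'b::real_normed_vector"
  assumes "g differentiable (at a)"
  shows "\<exists>C>0. \<exists>r>0. \<forall>y. norm (y - a) < r \<longrightarrow> norm (g y - g a) \<le> C * norm (y - a)"
proof -
  obtain g' where g': "(g has_derivative g') (at a)"
    using assms by (auto simp: differentiable_def)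
  then interpret bounded_linear g'
    by (rule has_derivative_bounded_linear)
  obtain r where r: "r > 0"
    "\<And>y. norm (y - a) < r \<Longrightarrow> norm (g y - g a - g' (y - a)) \<le> 1 * norm (y - a)"
    using g' unfolding has_derivative_at_alt by (meson zero_less_one)
  obtain K where K: "K > 0" "\<And>y. norm (g' y) \<le> norm y * K"
    using pos_bounded by blast
  have "norm (g y - g a) \<le> (1 + K) * norm (y - a)" if "norm (y - a) < r" for y
  proof -
    have "norm (g y - g a) \<le> norm (g y - g a - g' (y - a)) + norm (g' (y - a))"
      by (metis diff_add_cancel norm_triangle_ineq)
    then show ?thesis
      using r(2)[OF that] K(2)[of "y - a"] by (simp add: algebra_simps)
  qed
  with r(1) K(1) show ?thesis
    by (intro exI[of _ "1 + K"]) auto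
qed

text \<open>The bound holds for a local smooth extension, which agrees with \<open>g\<close> on
  \<open>A\<close>; hence \<open>A\<close> may be lower-dimensional.\<close>

lemma smooth_map_on_pointwise_lipschitz:
  assumes "smooth_map_on g A" "a \<in> A"
  shows "\<exists>C>0. \<exists>r>0. \<forall>y\<in>A. norm (y - a) < r \<longrightarrow> norm (g y - g a) \<le> C * norm (y - a)"
proof -
  obtain U G where U: "open U" "a \<in> U" "smooth_on G U" "\<forall>y\<in>U \<inter> A. G y = g y"
    using assms unfolding smooth_map_on_def by meson
  obtain s where s: "s > 0" "ball a s \<subseteq> U"
    using U openE by blast
  obtain C r where C: "C > 0" "r > 0"
    "\<forall>y. norm (y - a) < r \<longrightarrow> norm (G y - G a) \<le> C * norm (y - a)"
    using differentiable_pointwise_lipschitz[OF smooth_on_differentiable[OF U(3,2)]] by metis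
  have "norm (g y - g a) \<le> C * norm (y - a)" if "y \<in> A" "norm (y - a) < min r s" for y
  proof -
    have "y \<in> U"
      using s(2) that(2) by (auto simp: subset_iff dist_norm norm_minus_commute)
    then show ?thesis
      using U C(3) that assms(2) by force
  qed
  then show ?thesis
    using C s(1) by (intro exI[of _ C] conjI exI[of _ "min r s"]) auto
qed

section \<open>Tangent spaces as linear subspaces\<close>

text \<open>The definition by curves hides linearity. A slice chart flattens \<open>M\<close> to a
  subspace \<open>S\<close>, and a vector is the velocity of a curve in \<open>M\<close> exactly
  when the derivative \<open>D\<close> of the chart maps it into \<open>S\<close>.\<close>

lemma tangent_space_eq_vimage:
  fixes M :: "'a::euclidean_space set"
  assumes M: "embedded_submanifold m M" and x: "x \<in> M"
  obtains D :: "'a \<Rightarrow> 'a" and S where "linear D" "subspace S" "tangent_space M x = D -` S"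
proof -
  obtain U and V :: "'a set" and \<Psi> S where ch: "open U" "x \<in> U" "open V" "diffeo_on \<Psi> U V"
    "subspace S" "\<Psi> ` (U \<inter> M) = V \<inter> S"
    using M x unfolding embedded_submanifold_def by metis
  define \<Phi> where "\<Phi> = inv_into U \<Psi>"
  have bij: "bij_betw \<Psi> U V" and sm: "smooth_map_on \<Psi> U" "smooth_map_on \<Phi> V"
    using ch(4) by (auto simp: diffeo_on_def \<Phi>_def)
  have \<Phi>\<Psi>: "\<Phi> (\<Psi> y) = y" if "y \<in> U" for y
    using bij that by (simp add: \<Phi>_def bij_betw_inv_into_left)
  have \<Psi>x: "\<Psi> x \<in> V" "\<Psi> x \<in> S"
    using ch(2,6) x by blast+
  \<comment> \<open>\<open>smooth_map_on\<close> provides only local extensions, so the chart and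
    its inverse are differentiated through \<open>G1\<close> and \<open>G2\<close>.\<close>
  obtain U1 G1 where G1: "open U1" "x \<in> U1" "smooth_on G1 U1" "\<forall>y\<in>U1 \<inter> U. G1 y = \<Psi> y"
    using sm(1) ch(2) unfolding smooth_map_on_def by meson
  obtain U2 G2 where G2: "open U2" "\<Psi> x \<in> U2" "smooth_on G2 U2" "\<forall>y\<in>U2 \<inter> V. G2 y = \<Phi> y"
    using sm(2) \<Psi>x(1) unfolding smooth_map_on_def by meson
  define D where "D = frechet_derivative G1 (at x)"
  define E where "E = frechet_derivative G2 (at (\<Psi> x))"
  have dD: "(G1 has_derivative D) (at x)"
    unfolding D_def using smooth_on_differentiable[OF G1(3,2)] frechet_derivative_works by blast
  have dE: "(G2 has_derivative E) (at (\<Psi> x))"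
    unfolding E_def using smooth_on_differentiable[OF G2(3,2)] frechet_derivative_works by blast
  interpret D: bounded_linear D
    using dD by (rule has_derivative_bounded_linear)
  interpret E: bounded_linear E
    using dE by (rule has_derivative_bounded_linear)
  have G1x: "G1 x = \<Psi> x"
    using G1 ch(2) by blast
  \<comment> \<open>\<open>G2\<close> after \<open>G1\<close> is the identity near \<open>x\<close>,
    so by the chain rule \<open>E\<close> is a left inverse of \<open>D\<close>.\<close>
  have ED: "E (D v) = v" for v
  proof -
    have 1: "((\<lambda>y. G2 (G1 y)) has_derivative (\<lambda>v. E (D v))) (at x)"
      using has_derivative_compose[OF dD] dE G1x by metis
    have "isCont G1 x"
      using dD has_derivative_continuous by blast
    then have "\<forall>\<^sub>F y in nhds x. G1 y \<in> U2"
      using G2(1,2) G1x by (metis isCont_def tendsto_at_iff_tendsto_nhds topological_tendstoD)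
    moreover have "\<forall>\<^sub>F y in nhds x. y \<in> U1 \<inter> U"
      using G1 ch by (intro eventually_nhds_in_open) auto
    ultimately have "\<forall>\<^sub>F y in nhds x. G2 (G1 y) = y"
    proof eventually_elim
      case (elim y)
      then have "G1 y = \<Psi> y" "\<Psi> y \<in> V"
        using G1(4) bij by (auto simp: bij_betw_def)
      then show ?case
        using elim G2(4) \<Phi>\<Psi> by auto
    qed
    then obtain T where T: "open T" "x \<in> T" "\<And>y. y \<in> T \<Longrightarrow> G2 (G1 y) = y"
      by (auto simp: eventually_nhds)
    have "((\<lambda>y. y) has_derivative (\<lambda>v. E (D v))) (at x)"
      using has_derivative_transform_within_open[OF 1 T] .
    then have "(\<lambda>v. E (D v)) = (\<lambda>v. v)"
      using has_derivative_unique has_derivative_ident by blast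
    then show ?thesis
      by metis
  qed
  \<comment> \<open>Difference quotients of the curve, seen in the chart, lie in \<open>S\<close>;
    so does their limit \<open>D v\<close>, since \<open>S\<close> is closed.\<close>
  have "D v \<in> S" if v: "v \<in> tangent_space M x" for v
  proof -
    obtain \<gamma> e where \<gamma>: "e > 0" "\<gamma> ` {-e<..<e} \<subseteq> M" "\<gamma> 0 = x"
      "(\<gamma> has_vector_derivative v) (at 0)"
      using v by (auto simp: tangent_space_def curve_in_def)
    have d: "((\<lambda>s. G1 (\<gamma> s)) has_vector_derivative D v) (at 0)"
      using has_derivative_compose[of \<gamma> "\<lambda>s. s *\<^sub>R v" 0 UNIV G1 D] \<gamma>(3,4) dD
      by (simp add: has_vector_derivative_def D.scaleR)
    have "((\<lambda>s. norm (G1 (\<gamma> s) - G1 (\<gamma> 0) - s *\<^sub>R D v) / norm s) \<longlongrightarrow> 0) (at 0)"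
      using d by (simp add: has_vector_derivative_def has_derivative_iff_norm)
    then have "((\<lambda>s. norm ((G1 (\<gamma> s) - G1 (\<gamma> 0)) /\<^sub>R s - D v)) \<longlongrightarrow> 0) (at 0)"
    proof (rule Lim_transform_eventually)
      have "norm (G1 (\<gamma> s) - G1 (\<gamma> 0) - s *\<^sub>R D v) / norm s
          = norm ((G1 (\<gamma> s) - G1 (\<gamma> 0)) /\<^sub>R s - D v)" if "s \<noteq> 0" for s
      proof -
        have "(G1 (\<gamma> s) - G1 (\<gamma> 0)) /\<^sub>R s - D v = (G1 (\<gamma> s) - G1 (\<gamma> 0) - s *\<^sub>R D v) /\<^sub>R s"
          using that by (simp add: scaleR_diff_right)
        then show ?thesis
          by (simp add: divide_inverse_commute)
      qed
      then show "\<forall>\<^sub>F s in at 0. norm (G1 (\<gamma> s) - G1 (\<gamma> 0) - s *\<^sub>R D v) / norm s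
          = norm ((G1 (\<gamma> s) - G1 (\<gamma> 0)) /\<^sub>R s - D v)"
        by (simp add: eventually_at_filter)
    qed
    then have lim: "((\<lambda>s. (G1 (\<gamma> s) - G1 (\<gamma> 0)) /\<^sub>R s) \<longlongrightarrow> D v) (at 0)"
      by (simp add: tendsto_norm_zero_iff LIM_zero_iff)
    have "isCont \<gamma> 0"
      using \<gamma>(4) has_vector_derivative_continuous by blast
    then have "\<forall>\<^sub>F s in at 0. \<gamma> s \<in> U1 \<inter> U"
      using \<gamma>(3) G1(1,2) ch(1,2) unfolding isCont_def
      by (intro topological_tendstoD) auto
    moreover have "\<forall>\<^sub>F s::real in at 0. s \<in> {-e<..<e}"
      using \<gamma>(1) by (intro eventually_at_in_open') auto
    ultimately have "\<forall>\<^sub>F s in at 0. (G1 (\<gamma> s) - G1 (\<gamma> 0)) /\<^sub>R s \<in> S"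
    proof eventually_elim
      case (elim s)
      then have "\<gamma> s \<in> M" "G1 (\<gamma> s) = \<Psi> (\<gamma> s)"
        using \<gamma>(2) G1(4) by auto
      then have "G1 (\<gamma> s) \<in> S"
        using ch(6) elim by auto
      then show ?case
        using \<Psi>x(2) G1x \<gamma>(3) ch(5) by (auto intro!: subspace_scale subspace_diff)
    qed
    then show ?thesis
      using Lim_in_closed_set[OF closed_subspace[OF ch(5)] _ _ lim] by simp
  qed
  moreover have "v \<in> tangent_space M x" if v: "D v \<in> S" for v
  proof -
    \<comment> \<open>The line through \<open>\<Psi> x\<close> in direction \<open>D v\<close> stays
      in \<open>S\<close>; the inverse chart carries it back into \<open>M\<close>, with velocity
      \<open>E (D v) = v\<close>.\<close>
    define \<gamma> where "\<gamma> = (\<lambda>s. G2 (\<Psi> x + s *\<^sub>R D v))"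
    have "((\<lambda>s. \<Psi> x + s *\<^sub>R D v) \<longlongrightarrow> \<Psi> x + 0 *\<^sub>R D v) (nhds (0::real))"
      by (intro tendsto_intros) (simp add: filterlim_ident)
    then have "\<forall>\<^sub>F s in nhds 0. \<Psi> x + s *\<^sub>R D v \<in> U2 \<inter> V"
      using G2 ch(3) \<Psi>x(1) by (intro topological_tendstoD) auto
    then obtain e where e: "e > 0" "\<And>s. \<bar>s\<bar> < e \<Longrightarrow> \<Psi> x + s *\<^sub>R D v \<in> U2 \<inter> V"
      by (auto simp: eventually_nhds_metric dist_real_def)
    have "smooth_on \<gamma> {-e<..<e}"
      unfolding \<gamma>_def by (rule smooth_on_affine_compose[OF _ _ G2(3)]) (use e in force)+
    moreover have "\<gamma> s \<in> M" if "s \<in> {-e<..<e}" for s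
    proof -
      have "\<Psi> x + s *\<^sub>R D v \<in> U2 \<inter> V"
        using e(2)[of s] that by (simp add: abs_less_iff)
      moreover have "\<Psi> x + s *\<^sub>R D v \<in> S"
        by (intro subspace_add[OF ch(5)] subspace_scale[OF ch(5)] v \<Psi>x(2))
      ultimately have "\<Psi> x + s *\<^sub>R D v \<in> \<Psi> ` (U \<inter> M)"
        using ch(6) by blast
      then obtain y where y: "y \<in> U" "y \<in> M" "\<Psi> x + s *\<^sub>R D v = \<Psi> y"
        by auto
      have "\<gamma> s = \<Phi> (\<Psi> y)"
        using G2(4) \<open>\<Psi> x + s *\<^sub>R D v \<in> U2 \<inter> V\<close> unfolding \<gamma>_def y(3)
        by blast
      then show ?thesis
        using \<Phi>\<Psi> y by simp
    qed
    moreover have "\<gamma> 0 = x"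
      using G2(2,4) \<Psi>x(1) \<Phi>\<Psi> ch(2) by (simp add: \<gamma>_def)
    moreover have "(\<gamma> has_vector_derivative v) (at 0)"
    proof -
      have "((\<lambda>s::real. \<Psi> x + s *\<^sub>R D v) has_derivative (\<lambda>s. s *\<^sub>R D v)) (at 0)"
        by (auto intro!: derivative_eq_intros)
      then have "(\<gamma> has_derivative (\<lambda>s. E (s *\<^sub>R D v))) (at 0)"
        unfolding \<gamma>_def
        using has_derivative_compose[of "\<lambda>s. \<Psi> x + s *\<^sub>R D v" "\<lambda>s. s *\<^sub>R D v" 0 UNIV G2 E] dE
        by simp
      then show ?thesis
        by (simp add: has_vector_derivative_def E.scaleR ED)
    qed
    ultimately show ?thesis
      using e(1) unfolding tangent_space_def curve_in_def by blast
  qed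
  ultimately have "tangent_space M x = D -` S"
    by blast
  then show thesis
    using that D.linear_axioms ch(5) by blast
qed

lemma subspace_tangent_space:
  assumes "embedded_submanifold m M" "x \<in> M"
  shows "subspace (tangent_space M x)"
  using tangent_space_eq_vimage[OF assms] by (metis linear_subspace_vimage)

text \<open>The tangent space is a subspace, hence its own double orthogonal complement, and the
  columns of \<open>Bx\<close> span the first complement. Tangency thus becomes a linear equation
  that can be perturbed in \<open>x\<close>.\<close>

lemma tangent_space_eq_kernel:
  fixes Bx :: "real^'c^'n"
  assumes "embedded_submanifold m M" "x \<in> M"
    and "orthonormal_basis_columns Bx (normal_space_at M x)"
  shows "tangent_space M x = {u. transpose Bx *v u = 0}"
proof -
  have "tangent_space M x = orthogonal_comp (span (columns Bx))"
    using assms(3) orthogonal_comp_self[OF subspace_tangent_space[OF assms(1,2)]]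
    by (simp add: orthonormal_basis_columns_def normal_space_at_def)
  also have "\<dots> = {u. \<forall>k. orthogonal u (column k Bx)}"
    unfolding orthogonal_comp_def
    by (auto simp: columns_def orthogonal_commute intro: span_base orthogonal_to_span)
  also have "\<dots> = {u. transpose Bx *v u = 0}"
    by (simp add: orthogonal_def matrix_mult_dot vec_eq_iff inner_commute transpose_def column_def)
  finally show ?thesis .
qed

section \<open>Matrix bounds and corrections within a coordinate block\<close>

text \<open>\<open>norm A\<close> is the Frobenius norm, so this is Cauchy-Schwarz row by
  row.\<close>

lemma norm_matrix_vector_mult_le:
  fixes A :: "real^'c^'n"
  shows "norm (A *v q) \<le> norm A * norm q"
proof -
  have "norm (A *v q) = L2_set (\<lambda>i. \<bar>A $ i \<bullet> q\<bar>) UNIV"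
    by (simp add: norm_vec_def matrix_mult_dot)
  also have "\<dots> \<le> L2_set (\<lambda>i. norm (A $ i) * norm q) UNIV"
    by (intro L2_set_mono) (auto simp: Cauchy_Schwarz_ineq2)
  also have "\<dots> = norm A * norm q"
    by (simp add: L2_set_left_distrib norm_vec_def[of A])
  finally show ?thesis .
qed

lemma inner_transpose_matrix_vector:
  fixes A :: "real^'c^'n"
  shows "(transpose A *v u) \<bullet> p = u \<bullet> (A *v p)"
  by (simp add: dot_lmul_matrix flip: vector_transpose_matrix)

lemma norm_transpose_matrix_vector_mult_le:
  fixes A :: "real^'c^'n"
  shows "norm (transpose A *v u) \<le> norm A * norm u"
proof (cases "transpose A *v u = 0")
  case False
  define p where "p = transpose A *v u"
  have "norm p * norm p = u \<bullet> (A *v p)"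
    using inner_transpose_matrix_vector[of A u p]
    by (simp add: p_def power2_norm_eq_inner flip: power2_eq_square)
  also have "\<dots> \<le> norm u * norm (A *v p)"
    by (rule norm_cauchy_schwarz)
  also have "\<dots> \<le> norm u * (norm A * norm p)"
    by (intro mult_left_mono norm_matrix_vector_mult_le) auto
  finally show ?thesis
    using False by (simp add: p_def mult.commute mult.left_commute)
qed simp

text \<open>The lower bound makes the Gram map injective, hence surjective in finite dimension. The
  size of the solution \<open>A *v q\<close> follows from
  \<open>(norm (A *v q))\<^sup>2 = p \<bullet> q\<close>, with \<open>norm q\<close> bounded through
  \<open>\<alpha>\<close>.\<close>

lemma bounded_right_inverse_transpose:
  fixes A :: "real^'c^'n"
  assumes "\<alpha> > 0" and below: "\<And>q. \<alpha> * norm q \<le> norm (A *v q)"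
  obtains q where "transpose A *v (A *v q) = p" "norm (A *v q) \<le> norm p / \<alpha>"
proof -
  have inner: "(transpose A *v (A *v q)) \<bullet> q = (norm (A *v q))\<^sup>2" for q
    by (simp add: inner_transpose_matrix_vector power2_norm_eq_inner)
  have lin: "linear (\<lambda>q. transpose A *v (A *v q))"
    by (intro linearI) (simp_all add: matrix_vector_right_distrib matrix_vector_mult_scaleR)
  have "q = 0" if "transpose A *v (A *v q) = 0" for q
  proof -
    have "norm (A *v q) = 0"
      using inner[of q] that by simp
    then show ?thesis
      using below[of q] \<open>\<alpha> > 0\<close> by (simp add: mult_le_0_iff)
  qed
  then have "inj (\<lambda>q. transpose A *v (A *v q))"
    using linear_injective_0[OF lin] by blast
  then obtain q where q: "transpose A *v (A *v q) = p"
    using linear_injective_imp_surjective[OF lin] by (metis surjD)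
  have "(norm (A *v q))\<^sup>2 \<le> norm p * norm q"
    using inner[of q] q norm_cauchy_schwarz by metis
  also have "\<dots> \<le> norm p * (norm (A *v q) / \<alpha>)"
    using below[of q] \<open>\<alpha> > 0\<close> by (intro mult_left_mono) (auto simp: field_simps)
  finally have "norm (A *v q) * norm (A *v q) \<le> norm (A *v q) * (norm p / \<alpha>)"
    by (simp add: power2_eq_square mult.commute)
  then have "norm (A *v q) \<le> norm p / \<alpha>"
    using \<open>\<alpha> > 0\<close> by (cases "A *v q = 0") (auto dest: mult_left_le_imp_le simp del: times_divide_eq_right)
  then show thesis
    using that q by blast
qed

lemma row_blk_mult: "row_blk J A *v q = blk J (A *v q)"
  by (simp add: row_blk_def blk_def matrix_mult_dot vec_eq_iff)

lemma transpose_row_blk_mult: "transpose (row_blk J A) *v u = transpose A *v blk J u"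
  by (simp add: vec_eq_iff matrix_vector_mult_def transpose_def row_blk_def blk_def)
     (auto intro!: sum.cong)

lemma blk_eq_self: "supp u \<subseteq> J \<Longrightarrow> blk J u = u"
  by (auto simp: blk_def supp_def vec_eq_iff)

lemma supp_blk_subset: "supp (blk J u) \<subseteq> J"
  by (auto simp: blk_def supp_def)

lemma blk_idem: "blk J (blk J u) = blk J u"
  by (simp add: blk_def vec_eq_iff)

lemma blk_diff: "blk J (u - w) = blk J u - blk J w"
  by (simp add: blk_def vec_eq_iff)

lemma blk_add_compl: "blk J u + blk (- J) u = u"
  by (simp add: blk_def vec_eq_iff)

lemma norm_blk_le: "norm (blk J u) \<le> norm u"
  by (rule norm_le_componentwise_cart) (simp add: blk_def)

text \<open>Subtract from \<open>w\<close> a solution, supported in \<open>J\<close>, of the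
  equation with right-hand side \<open>transpose A *v w\<close>. The cost depends on
  \<open>A\<close> only through \<open>\<alpha>\<close>, so it is uniform over nearby
  matrices.\<close>

lemma kernel_correction:
  fixes A :: "real^'c^'n"
  assumes "\<alpha> > 0" and below: "\<And>q. \<alpha> * norm q \<le> norm (row_blk J A *v q)"
    and w: "supp w \<subseteq> J"
  obtains u where "supp u \<subseteq> J" "transpose A *v u = 0"
    "norm (w - u) \<le> norm (transpose A *v w) / \<alpha>"
proof -
  obtain q where q: "transpose (row_blk J A) *v (row_blk J A *v q) = transpose A *v w"
    "norm (row_blk J A *v q) \<le> norm (transpose A *v w) / \<alpha>"
    using bounded_right_inverse_transpose[OF assms(1,2)] by blast
  show thesis
  proof (rule that[of "w - row_blk J A *v q"])
    have "blk J (w - row_blk J A *v q) = w - row_blk J A *v q"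
      by (simp add: blk_diff row_blk_mult blk_idem blk_eq_self[OF w])
    then show "supp (w - row_blk J A *v q) \<subseteq> J"
      by (metis supp_blk_subset)
    show "transpose A *v (w - row_blk J A *v q) = 0"
      using q(1)
      by (simp add: matrix_vector_mult_diff_distrib transpose_row_blk_mult row_blk_mult blk_idem)
  qed (use q(2) in simp)
qed

section \<open>Stationarity on the support and the size of the proximal step\<close>

text \<open>This acts as the gradient of the 1-norm on vectors supported where \<open>x\<close> is
  nonzero; off the support of \<open>x\<close> its entries are 0, as
  \<open>sgn 0 = 0\<close>.\<close>

definition sgn_vec :: "real^'n \<Rightarrow> real^'n" where
  "sgn_vec x = (\<chi> i. sgn (x $ i))"

text \<open>A nonzero entry of a soft threshold keeps the sign of \<open>z\<close>, so there the map
  is a shift.\<close>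

lemma prox_l1_eqD:
  assumes "y = prox_l1 a z" "a \<ge> 0" "y $ i \<noteq> 0"
  shows "y $ i = z $ i - a * sgn (y $ i)"
proof -
  have y: "y $ i = max (\<bar>z $ i\<bar> - a) 0 * sgn (z $ i)"
    using assms(1) by (simp add: prox_l1_def)
  then have "\<bar>z $ i\<bar> > a"
    using assms(3) by (auto simp: max_def split: if_splits)
  then show ?thesis
    using y assms(2) by (auto simp: sgn_if max_def split: if_splits)
qed

text \<open>On the support of \<open>x + v\<close> the prox equation makes the left vector equal to
  \<open>- (Bx *v l)\<close>; elsewhere \<open>u\<close> vanishes. The remaining normal vector pairs
  to zero with \<open>u\<close>, which lies in the kernel of \<open>transpose Bx\<close>.\<close>

lemma multiplier_stationary:
  fixes Bx :: "real^'c^'n"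
  assumes mult: "is_multiplier M f \<mu> t Bx x l" and pos: "\<mu> > 0" "t > 0"
    and v: "v = prox_dir M f \<mu> t x" and u: "supp u \<subseteq> supp (x + v)" "transpose Bx *v u = 0"
  shows "(grad f x + (1 / t) *\<^sub>R v + \<mu> *\<^sub>R sgn_vec (x + v)) \<bullet> u = 0"
proof -
  define z where "z = x - t *\<^sub>R (grad f x + Bx *v l)"
  have y: "x + v = prox_l1 (t * \<mu>) z"
    using mult by (simp add: is_multiplier_def v z_def)
  have "(grad f x + (1 / t) *\<^sub>R v + \<mu> *\<^sub>R sgn_vec (x + v)) $ k * u $ k = - (Bx *v l) $ k * u $ k"
    for k
  proof (cases "u $ k = 0")
    case False
    then have "(x + v) $ k \<noteq> 0"
      using u(1) by (auto simp: supp_def)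
    then have "(x + v) $ k = z $ k - t * \<mu> * sgn ((x + v) $ k)"
      using prox_l1_eqD[OF y] pos by simp
    then have "v $ k = - t * (grad f x $ k + (Bx *v l) $ k) - t * \<mu> * sgn ((x + v) $ k)"
      by (simp add: z_def algebra_simps)
    then have "(1 / t) * v $ k = - (grad f x $ k + (Bx *v l) $ k) - \<mu> * sgn ((x + v) $ k)"
      using pos by (simp add: field_simps)
    then have "(grad f x + (1 / t) *\<^sub>R v + \<mu> *\<^sub>R sgn_vec (x + v)) $ k = - (Bx *v l) $ k"
      by (simp add: sgn_vec_def)
    then show ?thesis
      by simp
  qed simp
  then have "(grad f x + (1 / t) *\<^sub>R v + \<mu> *\<^sub>R sgn_vec (x + v)) \<bullet> u = - ((Bx *v l) \<bullet> u)"
    by (simp add: inner_vec_def flip: sum_negf)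
  also have "(Bx *v l) \<bullet> u = (transpose Bx *v u) \<bullet> l"
    by (simp add: inner_transpose_matrix_vector inner_commute[of u])
  finally show ?thesis
    using u(2) by simp
qed

text \<open>For equal signs the factor is 0. Otherwise the hypothesis forces \<open>u\<close> to
  have the sign of \<open>b\<close>: if \<open>a = 0\<close> then \<open>u = b\<close>, and if the
  signs are opposite then \<open>u\<close> is at least as far from 0 as \<open>b\<close>, on the
  same side.\<close>

lemma sgn_diff_mult_nonpos:
  fixes a b u :: real
  assumes "\<bar>u - (b - a)\<bar> \<le> \<bar>a\<bar>" "b \<noteq> 0"
  shows "(sgn a - sgn b) * u \<le> 0"
  using assms by (auto simp: sgn_if abs_if mult_le_0_iff split: if_splits)

text \<open>The signs of \<open>xs\<close> and of \<open>x + v\<close> are not compared beforehand: where they differ, the test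
  vector \<open>u\<close>, which is close to \<open>x + v - xs\<close>, has the sign for which the difference helps.\<close>

lemma prox_step_bound:
  fixes Bx Bs :: "real^'c^'n" and gx gs x xs v :: "real^'n"
  assumes pos: "t > 0" "\<mu> > 0" "\<alpha> > 0"
    and e: "norm (x - xs) \<le> e"
    and Bdiff: "norm (Bx - Bs) \<le> K * e" and Bx: "norm Bx \<le> N"
    and below: "\<And>q. \<alpha> * norm q \<le> norm (row_blk J Bx *v q)"
      "\<And>q. \<alpha> * norm q \<le> norm (row_blk J Bs *v q)"
    and gdiff: "norm (gx - gs) \<le> L * e"
    and stat_s: "\<And>u. supp u \<subseteq> J \<Longrightarrow> transpose Bs *v u = 0 \<Longrightarrow> (gs + \<mu> *\<^sub>R sgn_vec xs) \<bullet> u = 0"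
    and stat_x: "\<And>u. supp u \<subseteq> J \<Longrightarrow> transpose Bx *v u = 0 \<Longrightarrow>
        (gx + (1 / t) *\<^sub>R v + \<mu> *\<^sub>R sgn_vec (x + v)) \<bullet> u = 0"
    and supp: "supp (x + v) = J" "supp xs = J"
    and Bv: "transpose Bx *v v = 0"
    and small: "\<And>k. k \<in> J \<Longrightarrow> (2 + N / \<alpha>) * e \<le> \<bar>xs $ k\<bar>"
  shows "norm v \<le>
    (t * (norm (gs + \<mu> *\<^sub>R sgn_vec xs) * K / \<alpha> + L) + 2 * (1 + N / \<alpha>)) * e"
proof -
  define w h where "w = blk J v" and "h = blk (- J) v"
  define D where "D = 1 + N / \<alpha>"
  define S where "S = norm (gs + \<mu> *\<^sub>R sgn_vec xs)"
  have e0: "e \<ge> 0"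
    by (rule order_trans[OF norm_ge_zero e])
  have N0: "N \<ge> 0"
    by (rule order_trans[OF norm_ge_zero Bx])
  have v: "v = w + h"
    by (simp add: w_def h_def blk_add_compl)
  \<comment> \<open>Outside \<open>J\<close> both \<open>x + v\<close> and \<open>xs\<close> vanish,
    so there \<open>v\<close> equals \<open>- (x - xs)\<close>.\<close>
  have "h $ k = - blk (- J) (x - xs) $ k" for k
  proof (cases "k \<in> J")
    case False
    then have "(x + v) $ k = 0" "xs $ k = 0"
      using supp by (auto simp: supp_def)
    then show ?thesis
      by (simp add: h_def blk_def)
  qed (simp add: h_def blk_def)
  then have "h = - blk (- J) (x - xs)"
    by (simp add: vec_eq_iff)
  then have h: "norm h \<le> e"
    using norm_blk_le[of "- J" "x - xs"] e by simp
  have "transpose Bx *v w = - (transpose Bx *v h)"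
    using Bv by (simp add: v matrix_vector_right_distrib eq_neg_iff_add_eq_0)
  then have "norm (transpose Bx *v w) \<le> norm Bx * norm h"
    using norm_transpose_matrix_vector_mult_le[of Bx h] by simp
  also have "\<dots> \<le> N * e"
    using Bx h N0 by (intro mult_mono) auto
  finally have Bw: "norm (transpose Bx *v w) \<le> N * e" .
  \<comment> \<open>By \<open>Bv\<close>, \<open>w\<close> misses the kernel of
    \<open>transpose Bx\<close> only by the contribution of \<open>h\<close>, so correcting it costs
    \<open>O(e)\<close>.\<close>
  obtain u where u: "supp u \<subseteq> J" "transpose Bx *v u = 0"
    "norm (w - u) \<le> norm (transpose Bx *v w) / \<alpha>"
    using kernel_correction[OF pos(3) below(1)] supp_blk_subset unfolding w_def by blast
  have "norm (w - u) \<le> N * e / \<alpha>"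
    using u(3) Bw pos(3) by (meson divide_right_mono less_imp_le order_trans)
  moreover have "norm (v - u) \<le> norm (w - u) + norm h"
    using norm_triangle_ineq[of "w - u" h] by (simp add: v algebra_simps)
  ultimately have vu: "norm (v - u) \<le> D * e"
    using h by (simp add: D_def algebra_simps)
  \<comment> \<open>\<open>u\<close> need not be tangent at \<open>xs\<close>; the equation there is
    tested with a second correction, whose cost comes from the change of \<open>B\<close>.\<close>
  obtain u' where u': "supp u' \<subseteq> J" "transpose Bs *v u' = 0"
    "norm (u - u') \<le> norm (transpose Bs *v u) / \<alpha>"
    using kernel_correction[OF pos(3) below(2) u(1)] by blast
  have "transpose Bs *v u = - (transpose (Bx - Bs) *v u)"
    using u(2) by (simp add: transpose_def matrix_vector_mult_def vec_eq_iff left_diff_distrib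
        sum_subtractf)
  then have "norm (transpose Bs *v u) \<le> norm (Bx - Bs) * norm u"
    using norm_transpose_matrix_vector_mult_le[of "Bx - Bs" u] by simp
  also have "\<dots> \<le> K * e * norm u"
    using Bdiff by (intro mult_right_mono) auto
  finally have uu': "norm (u - u') \<le> K * e * norm u / \<alpha>"
    using u'(3) pos(3) by (meson divide_right_mono less_imp_le order_trans)
  have sgn: "(sgn_vec xs - sgn_vec (x + v)) \<bullet> u \<le> 0"
    unfolding inner_vec_def
  proof (rule sum_nonpos)
    fix k
    show "(sgn_vec xs - sgn_vec (x + v)) $ k \<bullet> u $ k \<le> 0"
    proof (cases "k \<in> J")
      case True
      have "\<bar>(u - v) $ k\<bar> \<le> D * e"
        using component_le_norm_cart[of "u - v" k] vu by (simp add: norm_minus_commute)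
      moreover have "\<bar>(x - xs) $ k\<bar> \<le> e"
        using component_le_norm_cart[of "x - xs" k] e by simp
      ultimately have "\<bar>u $ k - ((x + v) $ k - xs $ k)\<bar> \<le> D * e + e"
        by simp
      \<comment> \<open>The constant \<open>2 + N / \<alpha>\<close> in \<open>small\<close> is
        \<open>D + 1\<close>: \<open>D\<close> for \<open>v - u\<close> and 1 for
        \<open>x - xs\<close>.\<close>
      also have "\<dots> \<le> \<bar>xs $ k\<bar>"
        using small[OF True] by (simp add: D_def algebra_simps)
      finally have "\<bar>u $ k - ((x + v) $ k - xs $ k)\<bar> \<le> \<bar>xs $ k\<bar>" .
      moreover have "(x + v) $ k \<noteq> 0"
        using True supp(1) by (auto simp: supp_def)
      ultimately have "(sgn (xs $ k) - sgn ((x + v) $ k)) * u $ k \<le> 0"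
        by (rule sgn_diff_mult_nonpos)
      then show ?thesis
        by (simp add: sgn_vec_def)
    next
      case False
      then have "u $ k = 0"
        using u(1) by (auto simp: supp_def)
      then show ?thesis
        by simp
    qed
  qed
  \<comment> \<open>This is the equation at \<open>x\<close> tested with \<open>u\<close>, minus the
    one at \<open>xs\<close> tested with \<open>u'\<close>.\<close>
  have "(1 / t) * (v \<bullet> u) = - (gs + \<mu> *\<^sub>R sgn_vec xs) \<bullet> (u - u') - (gx - gs) \<bullet> u
      + \<mu> * ((sgn_vec xs - sgn_vec (x + v)) \<bullet> u)"
    using stat_x[OF u(1,2)] stat_s[OF u'(1,2)]
    by (simp add: inner_add_left inner_diff_left inner_diff_right algebra_simps)
  also have "\<dots> \<le> S * (K * e * norm u / \<alpha>) + L * e * norm u + 0"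
  proof (intro add_mono)
    have "- (gs + \<mu> *\<^sub>R sgn_vec xs) \<bullet> (u - u') \<le> S * norm (u - u')"
      using norm_cauchy_schwarz[of "- (gs + \<mu> *\<^sub>R sgn_vec xs)" "u - u'"]
      by (simp only: S_def norm_minus_cancel)
    also have "\<dots> \<le> S * (K * e * norm u / \<alpha>)"
      using uu' by (intro mult_left_mono) (auto simp: S_def)
    finally have "- (gs + \<mu> *\<^sub>R sgn_vec xs) \<bullet> (u - u') \<le> S * (K * e * norm u / \<alpha>)" .
    moreover have "- ((gx - gs) \<bullet> u) \<le> L * e * norm u"
      using norm_cauchy_schwarz[of "- (gx - gs)" u] mult_right_mono[OF gdiff norm_ge_zero, of u]
      by (simp only: norm_minus_cancel inner_minus_left)
    ultimately show "- (gs + \<mu> *\<^sub>R sgn_vec xs) \<bullet> (u - u') - (gx - gs) \<bullet> u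
        \<le> S * (K * e * norm u / \<alpha>) + L * e * norm u"
      by linarith
    show "\<mu> * ((sgn_vec xs - sgn_vec (x + v)) \<bullet> u) \<le> 0"
      using sgn pos(2) by (simp add: mult_le_0_iff)
  qed
  finally have "(v \<bullet> u) \<le> t * (S * (K * e * norm u / \<alpha>) + L * e * norm u)"
    using pos(1) by (simp add: field_simps)
  \<comment> \<open>Replacing \<open>v\<close> by \<open>u\<close> in \<open>v \<bullet> u\<close>
    costs \<open>D * e * norm u\<close>. The result is quadratic in \<open>norm u\<close> on the
    left and linear on the right, so one factor cancels.\<close>
  moreover have "norm u * norm u = v \<bullet> u - (v - u) \<bullet> u"
    by (simp add: inner_diff_left flip: power2_norm_eq_inner power2_eq_square)
  moreover have "- ((v - u) \<bullet> u) \<le> D * e * norm u"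
    using norm_cauchy_schwarz[of "- (v - u)" u] mult_right_mono[OF vu norm_ge_zero, of u]
    by (simp only: norm_minus_cancel inner_minus_left)
  ultimately have "norm u * norm u \<le> norm u * ((t * (S * K / \<alpha> + L) + D) * e)"
    by (simp add: algebra_simps)
  then have nu: "norm u \<le> (t * (S * K / \<alpha> + L) + D) * e" if "u \<noteq> 0"
    using that by (simp add: mult_le_cancel_left)
  \<comment> \<open>If \<open>u = 0\<close> nothing cancels and the bound itself must be
    nonnegative; the signs of \<open>K\<close> and \<open>L\<close> enter only through their
    products with \<open>e\<close>.\<close>
  have "0 \<le> K * e" "0 \<le> L * e"
    by (rule order_trans[OF norm_ge_zero Bdiff] order_trans[OF norm_ge_zero gdiff])+
  then have "0 \<le> t * (S * (K * e) / \<alpha> + L * e) + D * e"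
    using e0 N0 pos by (auto simp: S_def D_def)
  also have "\<dots> = (t * (S * K / \<alpha> + L) + D) * e"
    by (simp add: algebra_simps)
  finally have "norm u \<le> (t * (S * K / \<alpha> + L) + D) * e"
    using nu by (cases "u = 0") auto
  then have "norm v \<le> (t * (S * K / \<alpha> + L) + D) * e + D * e"
    using vu norm_triangle_ineq[of "v - u" u] by simp
  then show ?thesis
    by (simp add: S_def D_def algebra_simps)
qed

section \<open>First-order optimality at the local minimizer\<close>

text \<open>\<open>grad\<close> is a definite description: existence is the Riesz representation in
  the standard basis, uniqueness that of the derivative.\<close>

lemma has_derivative_grad:
  fixes f :: "'a::euclidean_space \<Rightarrow> real"
  assumes "f differentiable (at x)"
  shows "(f has_derivative (\<lambda>h. h \<bullet> grad f x)) (at x)"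
proof -
  obtain f' where f': "(f has_derivative f') (at x)"
    using assms by (auto simp: differentiable_def)
  then interpret bounded_linear f'
    by (rule has_derivative_bounded_linear)
  define g where "g = (\<Sum>b\<in>Basis. f' b *\<^sub>R b)"
  have "f' h = h \<bullet> g" for h
  proof -
    have "f' h = f' (\<Sum>b\<in>Basis. (h \<bullet> b) *\<^sub>R b)"
      by (simp add: euclidean_representation)
    also have "\<dots> = h \<bullet> g"
      by (simp add: sum scaleR g_def inner_sum_right mult.commute)
    finally show ?thesis .
  qed
  then have "f' = (\<lambda>h. h \<bullet> g)"
    by blast
  then have g: "GDERIV f x :> g"
    using f' by (simp add: gderiv_def)
  moreover have "g' = g" if "GDERIV f x :> g'" for g'
  proof -
    have "(\<lambda>h. h \<bullet> g') = (\<lambda>h. h \<bullet> g)"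
      using has_derivative_unique that g unfolding gderiv_def by blast
    then have "\<forall>h. h \<bullet> g' = h \<bullet> g"
      by meson
    then show ?thesis
      by (simp add: vector_eq_ldot)
  qed
  ultimately have "GDERIV f x :> grad f x"
    unfolding grad_def by (rule theI)
  then show ?thesis
    by (simp add: gderiv_def)
qed

text \<open>The kink of the absolute value is met only when \<open>\<phi> 0 = 0\<close>; then
  \<open>u = 0\<close>, so \<open>\<phi>\<close> and its absolute value are both
  \<open>o(s)\<close>.\<close>

lemma abs_has_derivative_along:
  assumes "(\<phi> has_real_derivative u) (at 0)" "\<phi> 0 = 0 \<Longrightarrow> u = 0"
  shows "((\<lambda>s. \<bar>\<phi> s\<bar>) has_real_derivative sgn (\<phi> 0) * u) (at (0::real))"
proof (cases "\<phi> 0 = 0")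
  case True
  then have "(\<phi> has_derivative (\<lambda>h. 0)) (at 0)"
    using assms by (simp add: has_field_derivative_def mult_zero_class.mult_zero_left[abs_def])
  then have "((\<lambda>s. \<bar>\<phi> s\<bar>) has_derivative (\<lambda>h. 0)) (at 0)"
    using True by (simp add: has_derivative_iff_norm)
  then show ?thesis
    using assms(2) True by (simp add: has_field_derivative_def mult_zero_class.mult_zero_left[abs_def])
next
  case False
  have "(abs has_real_derivative sgn (\<phi> 0)) (at (\<phi> 0))"
    using GDERIV_norm[OF False] by (simp add: real_norm_def[abs_def])
  then show ?thesis
    using DERIV_chain2 assms(1) by blast
qed

text \<open>Take a curve in \<open>M\<close> with velocity \<open>u\<close>. Since \<open>u\<close>
  vanishes wherever \<open>xs\<close> does, the objective is differentiable along it despite the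
  1-norm, and its interior minimum at parameter 0 has zero derivative.\<close>

lemma local_minimizer_stationary:
  fixes Bs :: "real^'c^'n"
  assumes M: "embedded_submanifold m M"
    and xs: "local_minimizer_on M (\<lambda>x. f x + \<mu> * l1norm x) xs"
    and f: "f differentiable (at xs)"
    and Bs: "orthonormal_basis_columns Bs (normal_space_at M xs)"
    and u: "supp u \<subseteq> supp xs" "transpose Bs *v u = 0"
  shows "(grad f xs + \<mu> *\<^sub>R sgn_vec xs) \<bullet> u = 0"
proof -
  have xsM: "xs \<in> M"
    using xs by (simp add: local_minimizer_on_def)
  have "u \<in> tangent_space M xs"
    using tangent_space_eq_kernel[OF M xsM Bs] u(2) by simp
  then obtain \<gamma> e where \<gamma>: "e > 0" "\<gamma> ` {-e<..<e} \<subseteq> M" "\<gamma> 0 = xs"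
    "(\<gamma> has_vector_derivative u) (at 0)"
    by (auto simp: tangent_space_def curve_in_def)
  have \<gamma>': "(\<gamma> has_derivative (\<lambda>s. s *\<^sub>R u)) (at 0)"
    using \<gamma>(4) by (simp add: has_vector_derivative_def)
  have "((\<lambda>s. f (\<gamma> s)) has_derivative (\<lambda>s. (s *\<^sub>R u) \<bullet> grad f xs)) (at 0)"
    using has_derivative_compose[OF \<gamma>', of f "\<lambda>h. h \<bullet> grad f xs"] has_derivative_grad[OF f]
    unfolding \<gamma>(3) by blast
  then have df: "((\<lambda>s. f (\<gamma> s)) has_real_derivative grad f xs \<bullet> u) (at 0)"
    by (simp add: has_field_derivative_def inner_commute mult_commute_abs)
  have dk: "((\<lambda>s. \<bar>\<gamma> s $ k\<bar>) has_real_derivative sgn (xs $ k) * u $ k) (at 0)" for k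
  proof -
    have "((\<lambda>s. \<gamma> s $ k) has_derivative (\<lambda>s. (s *\<^sub>R u) $ k)) (at 0)"
      using bounded_linear.has_derivative[OF bounded_linear_vec_nth \<gamma>'] .
    then have "((\<lambda>s. \<gamma> s $ k) has_real_derivative u $ k) (at 0)"
      by (simp add: has_field_derivative_def mult_commute_abs)
    moreover have "u $ k = 0" if "\<gamma> 0 $ k = 0"
      using that u(1) \<gamma>(3) by (auto simp: supp_def)
    ultimately have "((\<lambda>s. \<bar>\<gamma> s $ k\<bar>) has_real_derivative sgn (\<gamma> 0 $ k) * u $ k) (at 0)"
      by (rule abs_has_derivative_along)
    then show ?thesis
      by (simp add: \<gamma>(3))
  qed
  have "((\<lambda>s. f (\<gamma> s) + \<mu> * l1norm (\<gamma> s)) has_real_derivative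
      grad f xs \<bullet> u + \<mu> * (\<Sum>k\<in>UNIV. sgn (xs $ k) * u $ k)) (at 0)"
    unfolding l1norm_def by (intro DERIV_add df DERIV_cmult DERIV_sum dk)
  also have "grad f xs \<bullet> u + \<mu> * (\<Sum>k\<in>UNIV. sgn (xs $ k) * u $ k)
      = (grad f xs + \<mu> *\<^sub>R sgn_vec xs) \<bullet> u"
    by (simp add: inner_add_left) (simp add: inner_vec_def sgn_vec_def)
  finally have D: "((\<lambda>s. f (\<gamma> s) + \<mu> * l1norm (\<gamma> s)) has_real_derivative
      (grad f xs + \<mu> *\<^sub>R sgn_vec xs) \<bullet> u) (at 0)" .
  obtain V where V: "nbhd_on M xs V" "\<forall>y\<in>V. f xs + \<mu> * l1norm xs \<le> f y + \<mu> * l1norm y"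
    using xs by (auto simp: local_minimizer_on_def)
  then obtain U where U: "open U" "xs \<in> U" "U \<inter> M \<subseteq> V"
    by (auto simp: nbhd_on_def)
  have "isCont \<gamma> 0"
    using \<gamma>(4) has_vector_derivative_continuous by blast
  then have "\<forall>\<^sub>F s in nhds 0. \<gamma> s \<in> U"
    using U \<gamma>(3) by (metis isCont_def tendsto_at_iff_tendsto_nhds topological_tendstoD)
  then obtain e' where e': "e' > 0" "\<And>s. \<bar>s\<bar> < e' \<Longrightarrow> \<gamma> s \<in> U"
    by (auto simp: eventually_nhds_metric dist_real_def)
  have "\<forall>s. \<bar>0 - s\<bar> < min e e' \<longrightarrow>
      f (\<gamma> 0) + \<mu> * l1norm (\<gamma> 0) \<le> f (\<gamma> s) + \<mu> * l1norm (\<gamma> s)"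
  proof (intro allI impI)
    fix s assume s: "\<bar>0 - s\<bar> < min e e'"
    then have "\<gamma> s \<in> U" "\<gamma> s \<in> M"
      using e'(2) \<gamma>(2) by (auto simp: image_subset_iff abs_less_iff)
    then have "\<gamma> s \<in> V"
      using U(3) by blast
    then show "f (\<gamma> 0) + \<mu> * l1norm (\<gamma> 0) \<le> f (\<gamma> s) + \<mu> * l1norm (\<gamma> s)"
      using V(2) \<gamma>(3) by simp
  qed
  then show ?thesis
    using DERIV_local_min[OF D, of "min e e'"] \<gamma>(1) e'(1) by simp
qed

section \<open>Quadratic growth and the linear bound on the proximal step\<close>

text \<open>That \<open>riem_exp M x\<close> maps \<open>0\<close> to \<open>x\<close> is read off the growth inequality at \<open>x\<close> itself, so no
  uniqueness of geodesics is needed.\<close>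

lemma geod_strongly_convex_growth:
  assumes "geod_strongly_convex_at M F \<sigma> x" "\<sigma> > 0"
  obtains c r where "c > 0" "r > 0"
    "\<And>y. y \<in> M \<Longrightarrow> norm (y - x) < r \<Longrightarrow> F x + c * (norm (y - x))\<^sup>2 \<le> F y"
proof -
  obtain U W where UW: "openin (top_of_set M) U" "x \<in> U" "0 \<in> W"
    "diffeo_on (riem_exp M x) W U"
    "\<forall>y\<in>U. F y \<ge> F x + \<sigma> / 2 * (norm (inv_into W (riem_exp M x) y))\<^sup>2"
    using assms(1) unfolding geod_strongly_convex_at_def by blast
  define E where "E = riem_exp M x"
  define G where "G = inv_into W E"
  have bij: "bij_betw E W U" and sm: "smooth_map_on E W" "smooth_map_on G U"
    using UW(4) by (auto simp: diffeo_on_def E_def G_def)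
  have G: "G y \<in> W" "E (G y) = y" if "y \<in> U" for y
    using bij that
    by (simp_all add: G_def bij_betw_inv_into_right bij_betw_def inv_into_into)
  have "\<sigma> / 2 * (norm (G x))\<^sup>2 \<le> 0"
    using UW(5)[rule_format, OF UW(2)] by (simp add: G_def E_def)
  then have Gx: "G x = 0"
    using assms(2) by (simp add: mult_le_0_iff)
  have E0: "E 0 = x"
    using G(2)[OF UW(2)] Gx by simp
  obtain C1 r1 where 1: "C1 > 0" "r1 > 0"
    "\<forall>w\<in>W. norm (w - 0) < r1 \<longrightarrow> norm (E w - E 0) \<le> C1 * norm (w - 0)"
    using smooth_map_on_pointwise_lipschitz[OF sm(1) UW(3)] by blast
  obtain C2 r2 where 2: "C2 > 0" "r2 > 0"
    "\<forall>y\<in>U. norm (y - x) < r2 \<longrightarrow> norm (G y - G x) \<le> C2 * norm (y - x)"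
    using smooth_map_on_pointwise_lipschitz[OF sm(2) UW(2)] by blast
  obtain r3 where 3: "r3 > 0" "ball x r3 \<inter> M \<subseteq> U"
    using UW(1,2) unfolding openin_contains_ball by blast
  show thesis
  \<comment> \<open>The Lipschitz bound \<open>C1\<close> of the exponential map converts tangent
    lengths into distances; radius \<open>r1 / C2\<close> keeps \<open>G y\<close> where that bound
    holds.\<close>
  proof (rule that[of "\<sigma> / (2 * C1\<^sup>2)" "min (min r2 r3) (r1 / C2)"])
    fix y assume y: "y \<in> M" "norm (y - x) < min (min r2 r3) (r1 / C2)"
    then have yU: "y \<in> U"
      using 3(2) by (auto simp: dist_norm norm_minus_commute)
    have "norm (G y) \<le> C2 * norm (y - x)"
      using 2(3) yU y(2) Gx by simp
    also have "\<dots> < r1"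
      using y(2) 2(1) by (simp add: field_simps)
    finally have "norm (y - x) \<le> C1 * norm (G y)"
      using 1(3) G[OF yU] E0 by (metis diff_zero)
    then have "(norm (y - x))\<^sup>2 \<le> C1\<^sup>2 * (norm (G y))\<^sup>2"
      by (metis norm_ge_zero power_mono power_mult_distrib)
    then have "\<sigma> / (2 * C1\<^sup>2) * (norm (y - x))\<^sup>2 \<le> \<sigma> / (2 * C1\<^sup>2) * (C1\<^sup>2 * (norm (G y))\<^sup>2)"
      using assms(2) by (intro mult_left_mono) auto
    also have "\<dots> = \<sigma> / 2 * (norm (G y))\<^sup>2"
      using 1(1) by simp
    finally show "F x + \<sigma> / (2 * C1\<^sup>2) * (norm (y - x))\<^sup>2 \<le> F y"
      using UW(5)[rule_format, OF yU] by (simp add: G_def E_def)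
  qed (use assms(2) 1 2 3 in auto)
qed

lemma l1norm_diff_le:
  fixes x y :: "real^'n"
  shows "l1norm y - l1norm x \<le> real CARD('n) * norm (y - x)"
proof -
  have "l1norm y - l1norm x = (\<Sum>i\<in>UNIV. \<bar>y $ i\<bar> - \<bar>x $ i\<bar>)"
    by (simp add: l1norm_def sum_subtractf)
  also have "\<dots> \<le> (\<Sum>i\<in>(UNIV::'n set). norm (y - x))"
  proof (rule sum_mono)
    fix i
    show "\<bar>y $ i\<bar> - \<bar>x $ i\<bar> \<le> norm (y - x)"
      using component_le_norm_cart[of "y - x" i] by simp
  qed
  finally show ?thesis
    by simp
qed

lemma nbhd_on_ball:
  fixes x :: "'a::metric_space"
  assumes "nbhd_on M x V"
  obtains r where "r > 0" "\<And>y. y \<in> M \<Longrightarrow> dist y x < r \<Longrightarrow> y \<in> V"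
proof -
  obtain U where U: "open U" "x \<in> U" "U \<inter> M \<subseteq> V"
    using assms by (auto simp: nbhd_on_def)
  obtain r where "r > 0" "ball x r \<subseteq> U"
    using U openE by blast
  then show thesis
    using that[of r] U(3) by (auto simp: dist_commute subset_iff)
qed

text \<open>Near \<open>xs\<close> the hypotheses of \<open>prox_step_bound\<close> hold with
  constants independent of \<open>x\<close>, taking \<open>e = norm (x - xs)\<close>.\<close>

lemma prox_dir_pointwise_lipschitz:
  fixes M :: "(real^'n) set" and B :: "real^'n \<Rightarrow> real^'c^'n" and lam :: "real^'n \<Rightarrow> real^'c"
  assumes M: "embedded_submanifold m M"
    and pos: "\<mu> > 0" "t > 0"
    and B: "\<forall>x\<in>M. orthonormal_basis_columns (B x) (normal_space_at M x)"
    and B_smooth: "nbhd_on M xs V" "smooth_map_on B V"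
    and lam: "\<forall>x\<in>M. is_multiplier M f \<mu> t (B x) x (lam x)"
    and xs: "local_minimizer_on M (\<lambda>x. f x + \<mu> * l1norm x) xs"
    and f: "f differentiable (at xs)" and L: "L-lipschitz_on UNIV (grad f)"
    and U: "nbhd_on M xs U" "\<forall>x\<in>U. supp (x + prox_dir M f \<mu> t x) = supp xs"
    and rank: "rank (row_blk (supp xs) (B xs)) = CARD('c)"
  obtains C r where "C > 0" "r > 0"
    "\<And>x. x \<in> M \<Longrightarrow> norm (x - xs) < r \<Longrightarrow> norm (prox_dir M f \<mu> t x) \<le> C * norm (x - xs)"
proof -
  define J where "J = supp xs"
  have xsM: "xs \<in> M"
    using xs by (simp add: local_minimizer_on_def)
  obtain rU where rU: "rU > 0" "\<And>y. y \<in> M \<Longrightarrow> dist y xs < rU \<Longrightarrow> y \<in> U"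
    using nbhd_on_ball[OF U(1)] by metis
  obtain rV where rV: "rV > 0" "\<And>y. y \<in> M \<Longrightarrow> dist y xs < rV \<Longrightarrow> y \<in> V"
    using nbhd_on_ball[OF B_smooth(1)] by metis
  have "xs \<in> V"
    using rV xsM by simp
  then obtain K rB where K: "K > 0" "rB > 0"
    "\<forall>y\<in>V. norm (y - xs) < rB \<longrightarrow> norm (B y - B xs) \<le> K * norm (y - xs)"
    using smooth_map_on_pointwise_lipschitz[OF B_smooth(2)] by blast
  have "inj ((*v) (row_blk J (B xs)))"
    using rank by (simp add: full_rank_injective J_def)
  then obtain \<beta> where \<beta>: "\<beta> > 0" "\<And>q. \<beta> * norm q \<le> norm (row_blk J (B xs) *v q)"
    using linear_inj_bounded_below_pos[OF matrix_vector_mul_linear] by blast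
  \<comment> \<open>Half of \<open>\<beta>\<close> is given up so that the lower bound survives a
    perturbation of \<open>B xs\<close> of norm at most \<open>\<alpha>\<close>.\<close>
  define \<alpha> where "\<alpha> = \<beta> / 2"
  define N where "N = norm (B xs) + \<alpha>"
  have \<alpha>: "\<alpha> > 0"
    using \<beta>(1) by (simp add: \<alpha>_def)
  have N: "N > 0"
    using \<alpha> by (simp add: N_def add_nonneg_pos)
  \<comment> \<open>The inserted 1 keeps the minimum meaningful and positive when \<open>J\<close>
    is empty.\<close>
  define a where "a = Min (insert 1 ((\<lambda>k. \<bar>xs $ k\<bar>) ` J))"
  have a: "a > 0" "\<And>k. k \<in> J \<Longrightarrow> a \<le> \<bar>xs $ k\<bar>"
    by (auto simp: a_def J_def supp_def)
  define A where "A = norm (grad f xs + \<mu> *\<^sub>R sgn_vec xs) * K / \<alpha>"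
  define C where "C = t * (A + L) + 2 * (1 + N / \<alpha>)"
  have L0: "L \<ge> 0"
    using L lipschitz_on_nonneg by blast
  have "A \<ge> 0" "1 + N / \<alpha> > 0"
    using K(1) \<alpha> N by (simp_all add: A_def add_pos_pos)
  then have "C > 0"
    unfolding C_def using pos L0 by (intro add_nonneg_pos mult_nonneg_nonneg) auto
  \<comment> \<open>\<open>\<alpha> / K\<close> limits the change of \<open>B\<close> to
    \<open>\<alpha>\<close>; the last entry gives the smallness condition on the entries of
    \<open>xs\<close>.\<close>
  define r where "r = Min {rU, rV, rB, \<alpha> / K, a / (2 + N / \<alpha>)}"
  have "r > 0"
    using rU(1) rV(1) K(1,2) \<alpha> a(1) N by (simp add: r_def add_pos_pos)
  moreover have "norm (prox_dir M f \<mu> t x) \<le> C * norm (x - xs)"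
    if x: "x \<in> M" "norm (x - xs) < r" for x
  proof -
    define v where "v = prox_dir M f \<mu> t x"
    have small: "norm (x - xs) < rU" "norm (x - xs) < rV" "norm (x - xs) < rB"
      "norm (x - xs) < \<alpha> / K" "norm (x - xs) < a / (2 + N / \<alpha>)"
      using x(2) by (auto simp: r_def)
    have supp: "supp (x + v) = J"
      using U(2) rU(2) x(1) small(1) by (simp add: J_def v_def dist_norm)
    have Bd: "norm (B x - B xs) \<le> K * norm (x - xs)"
      using K(3) rV(2) x(1) small(2,3) by (simp add: dist_norm)
    also have "\<dots> \<le> \<alpha>"
      using small(4) K(1) by (simp add: field_simps)
    finally have Bd': "norm (B x - B xs) \<le> \<alpha>" .
    have "norm (B x) \<le> N"
      using norm_triangle_sub[of "B x" "B xs"] Bd' by (simp add: N_def)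
    have below_s: "\<alpha> * norm q \<le> norm (row_blk J (B xs) *v q)" for q
    proof -
      have "\<alpha> * norm q \<le> \<beta> * norm q"
        using \<beta>(1) by (intro mult_right_mono) (auto simp: \<alpha>_def)
      then show ?thesis
        using \<beta>(2)[of q] by linarith
    qed
    have below_x: "\<alpha> * norm q \<le> norm (row_blk J (B x) *v q)" for q
    proof -
      have "row_blk J (B x) *v q - row_blk J (B xs) *v q = blk J ((B x - B xs) *v q)"
        by (simp add: row_blk_mult blk_diff matrix_vector_mult_diff_rdistrib)
      then have "norm (row_blk J (B x) *v q - row_blk J (B xs) *v q)
          \<le> norm (B x - B xs) * norm q"
        using norm_blk_le norm_matrix_vector_mult_le order_trans by metis
      also have "\<dots> \<le> \<alpha> * norm q"
        using Bd' by (intro mult_right_mono) auto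
      finally have "norm (row_blk J (B xs) *v q) \<le> norm (row_blk J (B x) *v q) + \<alpha> * norm q"
        using norm_triangle_sub[of "row_blk J (B xs) *v q" "row_blk J (B x) *v q"]
        by (simp add: norm_minus_commute)
      then show ?thesis
        using \<beta>(2)[of q] by (simp add: \<alpha>_def)
    qed
    have "norm v \<le> (t * (norm (grad f xs + \<mu> *\<^sub>R sgn_vec xs) * K / \<alpha> + L) + 2 * (1 + N / \<alpha>))
        * norm (x - xs)"
    proof (rule prox_step_bound[where Bx = "B x" and Bs = "B xs" and gx = "grad f x" and J = J])
      show "norm (grad f x - grad f xs) \<le> L * norm (x - xs)"
        using lipschitz_onD[OF L, of x xs] by (simp add: dist_norm)
      show "(grad f xs + \<mu> *\<^sub>R sgn_vec xs) \<bullet> u = 0"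
        if "supp u \<subseteq> J" "transpose (B xs) *v u = 0" for u
        using local_minimizer_stationary[OF M xs f B[rule_format, OF xsM]] that by (simp add: J_def)
      show "(grad f x + (1 / t) *\<^sub>R v + \<mu> *\<^sub>R sgn_vec (x + v)) \<bullet> u = 0"
        if "supp u \<subseteq> J" "transpose (B x) *v u = 0" for u
        using multiplier_stationary[OF lam[rule_format, OF x(1)] pos v_def] that supp by simp
      show "transpose (B x) *v v = 0"
        using lam x(1) unfolding is_multiplier_def v_def by blast
      show "(2 + N / \<alpha>) * norm (x - xs) \<le> \<bar>xs $ k\<bar>" if "k \<in> J" for k
      proof -
        have "2 + N / \<alpha> > 0"
          using N \<alpha> by (simp add: add_pos_pos)
        then have "(2 + N / \<alpha>) * norm (x - xs) \<le> a"
          using small(5) by (simp only: pos_less_divide_eq mult.commute)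
        then show ?thesis
          using a(2)[OF that] by linarith
      qed
    qed (use pos \<alpha> Bd supp below_s below_x \<open>norm (B x) \<le> N\<close> J_def in auto)
    then show ?thesis
      by (simp add: C_def A_def v_def)
  qed
  ultimately show thesis
    using that \<open>C > 0\<close> by blast
qed

section \<open>Two superlinear steps and the decrease of the objective\<close>

text \<open>Two steps have order \<open>p * p\<close>, which exceeds 2 because
  \<open>p > sqrt 2\<close>. The surplus power of the distance tends to 0 and absorbs every
  constant.\<close>

lemma two_steps_superquadratic:
  fixes step :: "'a::real_normed_vector \<Rightarrow> 'a"
  assumes step: "\<And>x. x \<in> V \<Longrightarrow> norm (step x - xs) \<le> K * norm (x - xs) powr p"
    and inV: "\<And>x. x \<in> V \<Longrightarrow> step x \<in> V" and "K > 0" "p > sqrt 2" "\<eta> > 0"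
  obtains r where "r > 0"
    "\<And>x. x \<in> V \<Longrightarrow> norm (x - xs) < r \<Longrightarrow> norm (step (step x) - xs) \<le> \<eta> * (norm (x - xs))\<^sup>2"
proof -
  have p: "p > 0"
    using assms(4) real_sqrt_gt_zero[of 2] by linarith
  then have p2: "p * p > 2"
    using assms(4) mult_strict_mono[of "sqrt 2" p "sqrt 2" p] by simp
  define A where "A = K * K powr p"
  have "((\<lambda>e. e powr (p * p - 2)) \<longlongrightarrow> 0 powr (p * p - 2)) (at_right (0::real))"
    using p2 eventually_at_right_less[of "0::real"]
    by (intro tendsto_powr' tendsto_intros) (auto elim: eventually_mono)
  then have "((\<lambda>e. A * e powr (p * p - 2)) \<longlongrightarrow> A * 0) (at_right (0::real))"
    by (intro tendsto_mult tendsto_const) simp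
  then have "\<forall>\<^sub>F e in at_right 0. A * e powr (p * p - 2) < \<eta>"
    using \<open>\<eta> > 0\<close> by (intro order_tendstoD) auto
  then obtain r where r: "r > 0" "\<And>e. 0 < e \<Longrightarrow> e < r \<Longrightarrow> A * e powr (p * p - 2) < \<eta>"
    by (auto simp: eventually_at_right_field)
  have "norm (step (step x) - xs) \<le> \<eta> * (norm (x - xs))\<^sup>2"
    if x: "x \<in> V" "norm (x - xs) < r" for x
  proof -
    define e where "e = norm (x - xs)"
    have "norm (step (step x) - xs) \<le> K * norm (step x - xs) powr p"
      using step inV x(1) by blast
    also have "\<dots> \<le> K * (K * e powr p) powr p"
      using step[OF x(1)] p \<open>K > 0\<close> unfolding e_def
      by (intro mult_left_mono powr_mono2) auto
    also have "\<dots> = A * e powr (p * p)"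
      using \<open>K > 0\<close> by (simp add: A_def e_def powr_mult powr_powr)
    also have "\<dots> \<le> \<eta> * e\<^sup>2"
    \<comment> \<open>The limit controls only positive \<open>e\<close>; for \<open>e = 0\<close>
      both sides are 0, as \<open>0 powr (p * p) = 0\<close>.\<close>
    proof (cases "e = 0")
      case False
      then have e: "e > 0"
        by (simp add: e_def)
      have "e powr (p * p) = e powr (p * p - 2) * e powr 2"
        by (simp flip: powr_add)
      also have "e powr 2 = e\<^sup>2"
        using e by simp
      finally have "A * e powr (p * p) = (A * e powr (p * p - 2)) * e\<^sup>2"
        by simp
      also have "\<dots> \<le> \<eta> * e\<^sup>2"
        using r(2)[OF e] x(2) by (intro mult_right_mono) (auto simp: e_def)
      finally show ?thesis .
    qed simp
    finally show ?thesis
      by (simp add: e_def)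
  qed
  then show thesis
    using that r(1) by blast
qed

theorem proposition3p1:
  fixes M :: "(real^'n) set" and m :: nat
    and f F :: "real^'n \<Rightarrow> real" and \<mu> t vth \<gamma> \<tau> \<theta> \<kappa> :: real
    and R :: "real^'n \<Rightarrow> real^'n \<Rightarrow> real^'n"
    and B :: "real^'n \<Rightarrow> real^'c^'n" and lam :: "real^'n \<Rightarrow> real^'c"
    and v d :: "real^'n \<Rightarrow> real^'n" and xs :: "real^'n" and J :: "'n set"
  assumes M: "compact M" "embedded_submanifold m M" "CARD('n) = m + CARD('c)"
    and R: "retraction_on_mfd M R"
    and params: "\<mu> > 0" "t > 0" "vth > 0" "\<gamma> > 0" "\<tau> > 0" "\<theta> > 0" "0 < \<kappa>" "\<kappa> < 1"
    and F: "F = (\<lambda>x. f x + \<mu> * l1norm x)"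
    and v: "v = prox_dir M f \<mu> t"
    and B: "\<forall>x\<in>M. orthonormal_basis_columns (B x) (normal_space_at M x)"
    and B_smooth: "\<exists>V. nbhd_on M xs V \<and> smooth_map_on B V"
    and lam: "\<forall>x\<in>M. is_multiplier M f \<mu> t (B x) x (lam x)"
    and d: "d = search_dir M f \<mu> t vth \<gamma> \<tau> \<theta> \<kappa> B lam"
    and xs: "local_minimizer_on M F xs"
    and J: "J = supp xs"
    and i: "Ck_on 2 f UNIV" "\<exists>L. L-lipschitz_on UNIV (grad f)"
    and ii: "\<exists>U. nbhd_on M xs U \<and>
               (\<forall>x\<in>U. (\<forall>k\<in>J. (x + v x) $ k \<noteq> 0) \<and> (\<forall>k. k \<notin> J \<longrightarrow> (x + v x) $ k = 0))"
    and iii: "CARD('c) \<le> card J" "rank (row_blk J (B xs)) = CARD('c)"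
    and iv: "\<exists>\<sigma>>0. geod_strongly_convex_at M F \<sigma> xs"
    and v': "\<exists>V9 Cup vk. nbhd_on M xs V9 \<and> Cup > 0 \<and> vk > sqrt 2 \<and>
               (\<forall>x\<in>V9. norm (R x (d x) - xs) \<le> Cup * norm (x - xs) powr vk \<and> R x (d x) \<in> V9)"
  shows "\<exists>V10 \<rho>1. nbhd_on M xs V10 \<and> \<rho>1 > 0 \<and>
           (\<forall>x\<in>V10. let x1 = R x (d x); x2 = R x1 (d x1)
                     in F x2 \<le> F x - \<rho>1 * (norm (v x))\<^sup>2)"
proof -
  have xsM: "xs \<in> M"
    using xs by (simp add: local_minimizer_on_def)
  have fd: "f differentiable (at xs)"
    using i(1) by (simp add: numeral_2_eq_2)
  obtain L where L: "L-lipschitz_on UNIV (grad f)"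
    using i(2) by blast
  obtain \<sigma> where \<sigma>: "\<sigma> > 0" "geod_strongly_convex_at M F \<sigma> xs"
    using iv by blast
  obtain c rc where c: "c > 0" "rc > 0"
    "\<And>y. y \<in> M \<Longrightarrow> norm (y - xs) < rc \<Longrightarrow> F xs + c * (norm (y - xs))\<^sup>2 \<le> F y"
    using geod_strongly_convex_growth[OF \<sigma>(2,1)] by metis
  obtain V where V: "nbhd_on M xs V" "smooth_map_on B V"
    using B_smooth by blast
  obtain U where U: "nbhd_on M xs U"
    "\<forall>x\<in>U. (\<forall>k\<in>J. (x + v x) $ k \<noteq> 0) \<and> (\<forall>k. k \<notin> J \<longrightarrow> (x + v x) $ k = 0)"
    using ii by blast
  have suppU: "\<forall>x\<in>U. supp (x + prox_dir M f \<mu> t x) = supp xs"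
    using U(2) unfolding J v by (fastforce simp: supp_def)
  obtain C rv where C: "C > 0" "rv > 0"
    "\<And>x. x \<in> M \<Longrightarrow> norm (x - xs) < rv \<Longrightarrow> norm (v x) \<le> C * norm (x - xs)"
    using prox_dir_pointwise_lipschitz[OF M(2) params(1,2) B V lam xs[unfolded F] fd L U(1) suppU]
      iii(2) unfolding J v by metis
  obtain Cf rf where Cf: "Cf > 0" "rf > 0"
    "\<And>y. norm (y - xs) < rf \<Longrightarrow> norm (f y - f xs) \<le> Cf * norm (y - xs)"
    using differentiable_pointwise_lipschitz[OF fd] by metis
  define LF where "LF = Cf + \<mu> * real CARD('n)"
  have LF0: "LF > 0"
    using Cf(1) params(1) by (simp add: LF_def add_pos_nonneg)
  have LF: "F y - F xs \<le> LF * norm (y - xs)" if "norm (y - xs) < rf" for y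
    using Cf(3)[OF that] mult_left_mono[OF l1norm_diff_le[of y xs], of \<mu>] params(1)
    by (simp add: F LF_def algebra_simps)
  obtain V9 Cup vk where V9: "nbhd_on M xs V9" "Cup > 0" "vk > sqrt 2"
    "\<And>x. x \<in> V9 \<Longrightarrow> norm (R x (d x) - xs) \<le> Cup * norm (x - xs) powr vk"
    "\<And>x. x \<in> V9 \<Longrightarrow> R x (d x) \<in> V9"
    using v' by blast
  define step where "step = (\<lambda>x. R x (d x))"
  \<comment> \<open>With this choice the Lipschitz bound \<open>LF\<close> at \<open>xs\<close>
    turns two steps into an excess of at most half the quadratic growth.\<close>
  define \<eta> where "\<eta> = c / (2 * LF)"
  have \<eta>: "\<eta> > 0"
    using c(1) LF0 by (simp add: \<eta>_def)
  obtain rs where rs: "rs > 0" "\<And>x. x \<in> V9 \<Longrightarrow> norm (x - xs) < rs \<Longrightarrow>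
      norm (step (step x) - xs) \<le> \<eta> * (norm (x - xs))\<^sup>2"
    using two_steps_superquadratic[of V9 step xs Cup vk \<eta>] V9 \<eta> unfolding step_def by metis
  obtain r9 where r9: "r9 > 0" "\<And>y. y \<in> M \<Longrightarrow> dist y xs < r9 \<Longrightarrow> y \<in> V9"
    using nbhd_on_ball[OF V9(1)] by metis
  \<comment> \<open>The entries 1 and \<open>rf / \<eta>\<close> give
    \<open>\<eta> * e\<^sup>2 \<le> \<eta> * e < rf\<close>, so the second iterate lies where
    \<open>LF\<close> applies.\<close>
  define r where "r = Min {rc, rv, rs, r9, 1, rf / \<eta>}"
  have r: "r > 0"
    using c(2) C(2) rs(1) r9(1) Cf(2) \<eta> by (simp add: r_def)
  \<comment> \<open>The other half of the growth, \<open>c / 2 * e\<^sup>2\<close>, dominates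
    \<open>\<rho> * (norm (v x))\<^sup>2\<close> because
    \<open>norm (v x) \<le> C * e\<close>.\<close>
  define \<rho> where "\<rho> = c / (2 * C\<^sup>2)"
  have \<rho>: "\<rho> > 0"
    using c(1) C(1) by (simp add: \<rho>_def)
  have decrease: "F (step (step x)) \<le> F x - \<rho> * (norm (v x))\<^sup>2"
    if x: "x \<in> M" "norm (x - xs) < r" for x
  proof -
    define e where "e = norm (x - xs)"
    have e: "e < rc" "e < rv" "e < rs" "e < r9" "e < 1" "e < rf / \<eta>" "e \<ge> 0"
      using x(2) by (auto simp: r_def e_def)
    have close: "norm (step (step x) - xs) \<le> \<eta> * e\<^sup>2"
      using rs(2) r9(2) x(1) e(3,4) by (simp add: e_def dist_norm)
    also have "\<dots> \<le> \<eta> * e"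
      using e(5,7) \<eta> by (intro mult_left_mono) (auto simp: power2_eq_square mult_left_le)
    also have "\<dots> < rf"
      using e(6) \<eta> by (simp add: field_simps)
    finally have "F (step (step x)) - F xs \<le> LF * norm (step (step x) - xs)"
      by (rule LF)
    also have "\<dots> \<le> LF * (\<eta> * e\<^sup>2)"
      using close LF0 by (intro mult_left_mono) auto
    also have "\<dots> = c / 2 * e\<^sup>2"
      using LF0 by (simp add: \<eta>_def)
    finally have upper: "F (step (step x)) \<le> F xs + c / 2 * e\<^sup>2"
      by simp
    have lower: "F xs + c * e\<^sup>2 \<le> F x"
      using c(3) x(1) e(1) by (simp add: e_def)
    have "(norm (v x))\<^sup>2 \<le> (C * e)\<^sup>2"
      using C(3) x(1) e(2) by (intro power_mono) (auto simp: e_def)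
    then have "\<rho> * (norm (v x))\<^sup>2 \<le> \<rho> * (C * e)\<^sup>2"
      using \<rho> by (intro mult_left_mono) auto
    also have "\<dots> = c / 2 * e\<^sup>2"
      using C(1) by (simp add: \<rho>_def power_mult_distrib)
    finally show ?thesis
      using upper lower by (simp add: field_simps)
  qed
  have "nbhd_on M xs (ball xs r \<inter> M)"
    using r by (auto simp: nbhd_on_def intro!: exI[of _ "ball xs r"])
  moreover have "\<forall>x\<in>ball xs r \<inter> M. let x1 = R x (d x); x2 = R x1 (d x1)
      in F x2 \<le> F x - \<rho> * (norm (v x))\<^sup>2"
    using decrease by (auto simp: step_def Let_def dist_norm norm_minus_commute)
  ultimately show ?thesis
    using \<rho> by blast
qed

end
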